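(* Let $W$ be a non-affine irreducible finitely generated Coxeter group, with Tits form $B$ and Tits representation $\alpha:W\to \mathrm{O}_f(B)$, and let $\pi:\mathrm{O}_f(B)\to\mathrm{O}(\bar B)\to\mathrm{PO}(\bar B)$ be the composite natural projection. Then the homomorphism $\pi\circ\alpha$ embeds $W$ as a discrete, Zariski dense subgroup of $\mathrm{PO}(\bar{B})$; that is, $\pi\circ\alpha$ is injective and its image is discrete and Zariski dense in $\mathrm{PO}(\bar B)$.
   Context: Let $S$ be a finite set and $M=(m_{st})_{(s,t)\in S^2}$ a symmetric matrix with $1$'s on the diagonal and off-diagonal coefficients in $\{2,3,\dots,\infty\}$ (a Coxeter matrix). The associated Coxeter group is $W=\langle (\sigma_s)_{s\in S}\mid ((\sigma_s\sigma_t)^{m_{st}})_{(s,t)\in S^2}\rangle$, with the convention $x^\infty=1$. The Coxeter graph has vertex set $S$ and an edge between $s$ and $t$ if and only if $m_{st}\ge 3$. The group $W$ is called irreducible if this graph is connected and non-empty. The Tits form is the symmetric bilinear form $B$ on the real vector space $\mathbf{R}^{(S)}$ with basis $(e_s)_{s\in S}$ given by $B(e_s,e_t)=-\cos(\pi/m_{st})$ (so $B(e_s,e_t)=-1$ if $m_{st}=\infty$). An irreducible $W$ (with $S$ finite) is of spherical type (equivalently, finite) if $B$ is positive definite, and of affine type if $B$ is positive semidefinite with one-dimensional kernel. "Non-affine" means irreducible and of neither of these types. For $s\in S$ set $r_s(v)=v-2B(e_s,v)e_s$. The map $\sigma_s\mapsto r_s$ extends to a group homomorphism $\alpha$ from $W$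 to $\mathrm{GL}(\mathbf{R}^{(S)})$, called the Tits representation. $\mathrm{O}_f(B)$ denotes the group of linear automorphisms of $\mathbf{R}^{(S)}$ preserving $B$ and fixing pointwise $\mathrm{Ker}(B)$; it contains $\alpha(W)$. $\bar B$ is the non-degenerate bilinear form induced by $B$ on $\mathbf{R}^{(S)}/\mathrm{Ker}(B)$, $\mathrm{O}(\bar B)$ is its orthogonal group, and $\mathrm{PO}(\bar B)=\mathrm{O}(\bar B)/\{\pm1\}$, viewed as a real algebraic group. Discreteness refers to the ordinary (Lie group) topology. *)

theory Defs
  imports "HOL-Analysis.Analysis" "HOL-Algebra.Coset" "HOL-Algebra.Bij" "HOL-Library.Extended_Nat"
begin

section \<open>Groups given by generators and relators\<close>

text \<open>The letter \<open>(a, True)\<close> stands for the generator \<open>a\<close>, the letter \<open>(a, False)\<close> for its inverse.\<close>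

type_synonym 'a word = "('a \<times> bool) list"

inductive pres_eq :: "'a word set \<Rightarrow> 'a word \<Rightarrow> 'a word \<Rightarrow> bool" for R where
  refl: "pres_eq R u u"
| sym: "pres_eq R u v \<Longrightarrow> pres_eq R v u"
| trans: "pres_eq R u v \<Longrightarrow> pres_eq R v w \<Longrightarrow> pres_eq R u w"
| cancel: "pres_eq R (u @ [(a, b), (a, \<not> b)] @ v) (u @ v)"
| relator: "r \<in> R \<Longrightarrow> pres_eq R (u @ r @ v) (u @ v)"

definition pres_class :: "'a word set \<Rightarrow> 'a word \<Rightarrow> 'a word set" where
  "pres_class R w = {w'. pres_eq R w w'}"

definition presented_group :: "'a word set \<Rightarrow> 'a word set monoid" where
  "presented_group R =
    \<lparr>carrier = range (pres_class R),
     mult = (\<lambda>X Y. (\<Union>x\<in>X. \<Union>y\<in>Y. pres_class R (x @ y))),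
     one = pres_class R []\<rparr>"

lemma pres_eq_append_left: "pres_eq R u v \<Longrightarrow> pres_eq R (x @ u) (x @ v)"
proof (induction rule: pres_eq.induct)
  case (cancel u a b v)
  then show ?case using pres_eq.cancel[of R "x @ u" a b v] by simp
next
  case (relator r u v)
  then show ?case using pres_eq.relator[of r R "x @ u" v] by simp
qed (blast intro: pres_eq.refl pres_eq.sym pres_eq.trans)+

lemma pres_eq_append_right: "pres_eq R u v \<Longrightarrow> pres_eq R (u @ x) (v @ x)"
proof (induction rule: pres_eq.induct)
  case (cancel u a b v)
  then show ?case using pres_eq.cancel[of R u a b "v @ x"] by simp
next
  case (relator r u v)
  then show ?case using pres_eq.relator[of r R u "v @ x"] by simp
qed (blast intro: pres_eq.refl pres_eq.sym pres_eq.trans)+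

lemma pres_eq_append: "pres_eq R u v \<Longrightarrow> pres_eq R x y \<Longrightarrow> pres_eq R (u @ x) (v @ y)"
  by (blast intro: pres_eq_append_left pres_eq_append_right pres_eq.trans)

lemma pres_class_eq_iff: "pres_class R u = pres_class R v \<longleftrightarrow> pres_eq R u v"
  unfolding pres_class_def by (blast intro: pres_eq.intros)

lemma pres_class_mult:
  "pres_class R u \<otimes>\<^bsub>presented_group R\<^esub> pres_class R v = pres_class R (u @ v)"
proof -
  have *: "pres_class R (x @ y) = pres_class R (u @ v)"
    if "x \<in> pres_class R u" "y \<in> pres_class R v" for x y
    using that unfolding pres_class_eq_iff
    by (auto simp: pres_class_def intro: pres_eq_append pres_eq.sym)
  have "u \<in> pres_class R u" "v \<in> pres_class R v"
    by (auto simp: pres_class_def intro: pres_eq.refl)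
  with * have "(\<Union>x\<in>pres_class R u. \<Union>y\<in>pres_class R v. pres_class R (x @ y))
      = pres_class R (u @ v)"
    by blast
  then show ?thesis by (simp add: presented_group_def)
qed

lemma pres_eq_inverse: "\<exists>v. pres_eq R (v @ u) []"
proof (induction u)
  case Nil
  show ?case using pres_eq.refl by (metis append_Nil)
next
  case (Cons p u)
  obtain v where v: "pres_eq R (v @ u) []" using Cons by blast
  obtain a b where p: "p = (a, b)" by (cases p)
  have "pres_eq R ((v @ [(a, \<not> b)]) @ p # u) (v @ u)"
    using pres_eq.cancel[of R v a "\<not> b" u] p by simp
  then show ?case using v by (blast intro: pres_eq.trans)
qed

lemma group_presented_group: "Group.group (presented_group R)"
proof (rule groupI)
  show "\<one>\<^bsub>presented_group R\<^esub> \<in> carrier (presented_group R)"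
    by (simp add: presented_group_def)
next
  fix X assume "X \<in> carrier (presented_group R)"
  then obtain x where x: "X = pres_class R x" by (auto simp: presented_group_def)
  obtain y where "pres_eq R (y @ x) []" using pres_eq_inverse by blast
  then show "\<exists>Y\<in>carrier (presented_group R).
      Y \<otimes>\<^bsub>presented_group R\<^esub> X = \<one>\<^bsub>presented_group R\<^esub>"
    unfolding x by (intro bexI[of _ "pres_class R y"])
      (simp_all only: pres_class_mult, auto simp: presented_group_def pres_class_eq_iff)
  show "\<one>\<^bsub>presented_group R\<^esub> \<otimes>\<^bsub>presented_group R\<^esub> X = X"
    using pres_class_mult[of R "[]" x] by (simp add: x presented_group_def)
next
  fix X Y assume "X \<in> carrier (presented_group R)" "Y \<in> carrier (presented_group R)"
  then obtain x y where xy: "X = pres_class R x" "Y = pres_class R y"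
    by (auto simp: presented_group_def)
  show "X \<otimes>\<^bsub>presented_group R\<^esub> Y \<in> carrier (presented_group R)"
    unfolding xy pres_class_mult by (simp add: presented_group_def)
  fix Z assume "Z \<in> carrier (presented_group R)"
  then obtain z where z: "Z = pres_class R z" by (auto simp: presented_group_def)
  show "X \<otimes>\<^bsub>presented_group R\<^esub> Y \<otimes>\<^bsub>presented_group R\<^esub> Z
      = X \<otimes>\<^bsub>presented_group R\<^esub> (Y \<otimes>\<^bsub>presented_group R\<^esub> Z)"
    unfolding xy z pres_class_mult by simp
qed


section \<open>Coxeter groups and the Tits representation\<close>

definition coxeter_matrix :: "('s \<Rightarrow> 's \<Rightarrow> enat) \<Rightarrow> bool" where
  "coxeter_matrix m \<longleftrightarrow>
    (\<forall>s. m s s = 1) \<and> (\<forall>s t. m s t = m t s) \<and> (\<forall>s t. s \<noteq> t \<longrightarrow> m s t \<ge> 2)"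

definition coxeter_relators :: "('s \<Rightarrow> 's \<Rightarrow> enat) \<Rightarrow> 's word set" where
  "coxeter_relators m =
    {concat (replicate k [(s, True), (t, True)]) | s t k. m s t = enat k}"

definition coxeter_group :: "('s \<Rightarrow> 's \<Rightarrow> enat) \<Rightarrow> 's word set monoid" where
  "coxeter_group m = presented_group (coxeter_relators m)"

definition coxeter_graph :: "('s \<Rightarrow> 's \<Rightarrow> enat) \<Rightarrow> ('s \<times> 's) set" where
  "coxeter_graph m = {(s, t). m s t \<ge> 3}"

text \<open>The vertex set is a type, hence non-empty.\<close>

definition coxeter_irreducible :: "('s \<Rightarrow> 's \<Rightarrow> enat) \<Rightarrow> bool" where
  "coxeter_irreducible m \<longleftrightarrow> (\<forall>s t. (s, t) \<in> (coxeter_graph m)\<^sup>*)"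

definition tits_coeff :: "('s \<Rightarrow> 's \<Rightarrow> enat) \<Rightarrow> 's \<Rightarrow> 's \<Rightarrow> real" where
  "tits_coeff m s t = (case m s t of enat k \<Rightarrow> - cos (pi / real k) | \<infinity> \<Rightarrow> -1)"

definition tits_form :: "('s::finite \<Rightarrow> 's \<Rightarrow> enat) \<Rightarrow> real ^ 's \<Rightarrow> real ^ 's \<Rightarrow> real" where
  "tits_form m x y = (\<Sum>s\<in>UNIV. \<Sum>t\<in>UNIV. x $ s * y $ t * tits_coeff m s t)"

definition form_ker :: "('v \<Rightarrow> 'v \<Rightarrow> real) \<Rightarrow> 'v set" where
  "form_ker B = {v. \<forall>w. B v w = 0}"

definition spherical_type :: "('s::finite \<Rightarrow> 's \<Rightarrow> enat) \<Rightarrow> bool" where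
  "spherical_type m \<longleftrightarrow> coxeter_irreducible m \<and> (\<forall>v. v \<noteq> 0 \<longrightarrow> tits_form m v v > 0)"

definition affine_type :: "('s::finite \<Rightarrow> 's \<Rightarrow> enat) \<Rightarrow> bool" where
  "affine_type m \<longleftrightarrow> coxeter_irreducible m \<and>
    (\<forall>v. tits_form m v v \<ge> 0) \<and> dim (form_ker (tits_form m)) = 1"

definition non_affine :: "('s::finite \<Rightarrow> 's \<Rightarrow> enat) \<Rightarrow> bool" where
  "non_affine m \<longleftrightarrow> coxeter_irreducible m \<and> \<not> spherical_type m \<and> \<not> affine_type m"

definition tits_refl :: "('s::finite \<Rightarrow> 's \<Rightarrow> enat) \<Rightarrow> 's \<Rightarrow> real ^ 's \<Rightarrow> real ^ 's" where
  "tits_refl m s v = v - (2 * tits_form m (axis s 1) v) *\<^sub>R axis s 1"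

definition tits_word :: "('s::finite \<Rightarrow> 's \<Rightarrow> enat) \<Rightarrow> 's word \<Rightarrow> real ^ 's \<Rightarrow> real ^ 's" where
  "tits_word m w =
    foldr (\<lambda>(s, b) f. (if b then tits_refl m s else inv_into UNIV (tits_refl m s)) \<circ> f) w id"

text \<open>The common value of \<^const>\<open>tits_word\<close> on a class of words; see \<open>tits_rep_pres_class\<close> below.\<close>

definition tits_rep :: "('s::finite \<Rightarrow> 's \<Rightarrow> enat) \<Rightarrow> 's word set \<Rightarrow> real ^ 's \<Rightarrow> real ^ 's" where
  "tits_rep m X = (THE f. \<forall>w\<in>X. tits_word m w = f)"

lemma bilinear_tits_form: "bilinear (tits_form m)"
proof -
  have "tits_form m x (y + z) = tits_form m x y + tits_form m x z"
    and "tits_form m (y + z) x = tits_form m y x + tits_form m z x" for x y z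
    by (simp_all add: tits_form_def ring_distribs sum.distrib)
  moreover have "tits_form m x (c *\<^sub>R y) = c *\<^sub>R tits_form m x y"
    and "tits_form m (c *\<^sub>R y) x = c *\<^sub>R tits_form m y x" for x y c
    by (simp_all add: tits_form_def sum_distrib_left mult.left_commute mult.assoc)
  ultimately show ?thesis unfolding bilinear_def by (auto intro!: linearI)
qed

lemma tits_form_sym:
  assumes "coxeter_matrix m"
  shows "tits_form m x y = tits_form m y x"
proof -
  have "tits_coeff m s t = tits_coeff m t s" for s t
    using assms unfolding coxeter_matrix_def tits_coeff_def by metis
  then have "x $ s * y $ t * tits_coeff m s t = y $ t * x $ s * tits_coeff m t s" for s t
    by simp
  then have "tits_form m x y = (\<Sum>s\<in>UNIV. \<Sum>t\<in>UNIV. y $ t * x $ s * tits_coeff m t s)"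
    unfolding tits_form_def by (simp only:)
  then show ?thesis unfolding tits_form_def by (subst sum.swap)
qed

lemma tits_form_axis [simp]: "tits_form m (axis s 1) (axis t 1) = tits_coeff m s t"
proof -
  have "tits_form m (axis s 1) (axis t 1) =
      (\<Sum>i\<in>UNIV. \<Sum>j\<in>UNIV. if i = s then if j = t then tits_coeff m i j else 0 else 0)"
    unfolding tits_form_def by (intro sum.cong) (auto simp: axis_def)
  also have "\<dots> = (\<Sum>i\<in>UNIV. if i = s then tits_coeff m i t else 0)"
    by (intro sum.cong) (auto simp: sum.delta)
  finally show ?thesis by (simp add: sum.delta)
qed

lemma tits_coeff_diag: "coxeter_matrix m \<Longrightarrow> tits_coeff m s s = 1"
  unfolding coxeter_matrix_def tits_coeff_def by (simp add: one_enat_def)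

lemmas tits_form_simps =
  bilinear_ladd[OF bilinear_tits_form] bilinear_radd[OF bilinear_tits_form]
  bilinear_lsub[OF bilinear_tits_form] bilinear_rsub[OF bilinear_tits_form]
  bilinear_lmul[OF bilinear_tits_form] bilinear_rmul[OF bilinear_tits_form]

lemma linear_tits_refl: "linear (tits_refl m s)"
  unfolding tits_refl_def
  by (rule linearI) (simp_all add: tits_form_simps vec_eq_iff ring_distribs)

lemma tits_refl_involution:
  assumes "coxeter_matrix m"
  shows "tits_refl m s (tits_refl m s v) = v"
  unfolding tits_refl_def
  by (simp add: tits_form_simps tits_coeff_diag[OF assms] algebra_simps)

lemma tits_refl_preserves:
  assumes "coxeter_matrix m"
  shows "tits_form m (tits_refl m s v) (tits_refl m s w) = tits_form m v w"
  unfolding tits_refl_def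
  by (simp add: tits_form_simps tits_coeff_diag[OF assms] tits_form_sym[OF assms, of v "axis s 1"]
      algebra_simps)

lemma tits_refl_inv:
  assumes "coxeter_matrix m"
  shows "inv_into UNIV (tits_refl m s) = tits_refl m s"
  by (rule inv_equality) (simp_all add: tits_refl_involution[OF assms])

text \<open>Explicit powers of a product of two reflections, where \<open>c = - B(e\<^sub>s, e\<^sub>t) = cos \<theta>\<close>.\<close>

lemma tits_refl_pair_power:
  assumes m: "coxeter_matrix m" and c: "tits_coeff m s t = - cos \<theta>" and \<theta>: "sin \<theta> \<noteq> 0"
  defines "S \<equiv> \<lambda>i. sin (i * \<theta>) / sin \<theta>"
  shows "((tits_refl m s \<circ> tits_refl m t) ^^ n) v =
    v - (2 * S n * (tits_form m (axis s 1) v * S (real n - 1) + tits_form m (axis t 1) v * S n)) *\<^sub>R axis t 1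
      - (2 * S n * (tits_form m (axis s 1) v * S n + tits_form m (axis t 1) v * S (real n + 1))) *\<^sub>R axis s 1"
proof (induction n)
  case 0
  show ?case by (simp add: S_def)
next
  case (Suc n)
  define a where "a = tits_form m (axis s 1) v"
  define b where "b = tits_form m (axis t 1) v"
  define C where "C = cos \<theta>"
  define x where "x = S (real n)"
  define y where "y = S (real n + 1)"
  have rec: "S (r + 1) = 2 * C * S r - S (r - 1)" for r
    unfolding S_def C_def using \<theta> by (simp add: field_simps sin_add sin_diff)
  have pyth: "y\<^sup>2 - 2 * C * x * y + x\<^sup>2 = 1"
  proof -
    have "y * sin \<theta> = sin (real n * \<theta>) * C + cos (real n * \<theta>) * sin \<theta>"
      unfolding y_def S_def C_def using \<theta> by (simp add: field_simps sin_add)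
    then have "y * sin \<theta> = (x * C + cos (real n * \<theta>)) * sin \<theta>"
      unfolding x_def S_def using \<theta> by (simp add: field_simps)
    then have y: "y = x * C + cos (real n * \<theta>)" using \<theta> by simp
    have "y\<^sup>2 - 2 * C * x * y + x\<^sup>2 = (cos (real n * \<theta>))\<^sup>2 + x\<^sup>2 * (1 - C\<^sup>2)"
      unfolding y by (simp add: power2_eq_square algebra_simps)
    also have "1 - C\<^sup>2 = (sin \<theta>)\<^sup>2" unfolding C_def by (simp add: sin_squared_eq)
    also have "x\<^sup>2 * (sin \<theta>)\<^sup>2 = (sin (real n * \<theta>))\<^sup>2"
      unfolding x_def S_def using \<theta> by (simp add: power_divide)
    finally show ?thesis by simp
  qed
  have Sm: "S (real n - 1) = 2 * C * x - y" using rec[of "real n"] by (simp add: x_def y_def)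
  have Sp: "S (real n + 1 + 1) = 2 * C * y - x" using rec[of "real n + 1"] by (simp add: x_def y_def)
  have ct: "tits_coeff m s t = - C" "tits_coeff m t s = - C"
    using c m unfolding C_def coxeter_matrix_def tits_coeff_def by auto
  define p where "p = 2 * x * (a * (2 * C * x - y) + b * x)"
  define q where "q = 2 * x * (a * x + b * y)"
  define p' where "p' = 2 * y * (a * x + b * y)"
  define q' where "q' = 2 * y * (a * y + b * (2 * C * y - x))"
  have IH: "((tits_refl m s \<circ> tits_refl m t) ^^ n) v = v - p *\<^sub>R axis t 1 - q *\<^sub>R axis s 1"
    using Suc unfolding Sm p_def q_def a_def b_def x_def[symmetric] y_def[symmetric] .
  have step: "tits_refl m s (tits_refl m t (v - p *\<^sub>R axis t 1 - q *\<^sub>R axis s 1)) =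
     v - (2 * b - p + 2 * q * C) *\<^sub>R axis t 1
       - (2 * (a + p * C - q) + 2 * C * (2 * (b - p + q * C)) + q) *\<^sub>R axis s 1"
    unfolding tits_refl_def
    by (simp add: tits_form_simps tits_coeff_diag[OF m] ct a_def[symmetric] b_def[symmetric]
        vec_eq_iff ring_distribs)
  have e1: "2 * b - p + 2 * q * C = p'"
  proof -
    have "2 * b * (y\<^sup>2 - 2 * C * x * y + x\<^sup>2) - p + 2 * q * C = p'"
      unfolding p_def q_def p'_def by (simp add: power2_eq_square algebra_simps)
    then show ?thesis unfolding pyth by simp
  qed
  have e2: "2 * (a + p * C - q) + 2 * C * (2 * (b - p + q * C)) + q = q'"
  proof -
    have "2 * (a + p * C - q) + 2 * C * (2 * (b - p + q * C)) + q =
        2 * a - q - 2 * C * p + 4 * C * b + 4 * C * C * q"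
      by (simp add: algebra_simps)
    also have "\<dots> = 2 * a * (y\<^sup>2 - 2 * C * x * y + x\<^sup>2) - q - 2 * C * p
        + 4 * C * b * (y\<^sup>2 - 2 * C * x * y + x\<^sup>2) + 4 * C * C * q"
      unfolding pyth by simp
    also have "\<dots> = q'"
      unfolding p_def q_def q'_def by (simp add: power2_eq_square algebra_simps)
    finally show ?thesis .
  qed
  have "((tits_refl m s \<circ> tits_refl m t) ^^ Suc n) v = v - p' *\<^sub>R axis t 1 - q' *\<^sub>R axis s 1"
    using IH step unfolding e1 e2 by simp
  then show ?case
    unfolding p'_def q'_def a_def b_def using Sp
    by (simp add: x_def y_def add.commute o_def)
qed

lemma tits_refl_pair_relation:
  assumes m: "coxeter_matrix m" and k: "m s t = enat k"
  shows "(tits_refl m s \<circ> tits_refl m t) ^^ k = id"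
proof (cases "s = t")
  case True
  then have "tits_refl m s \<circ> tits_refl m t = id"
    by (simp add: fun_eq_iff tits_refl_involution[OF m])
  then show ?thesis by simp
next
  case False
  then have "enat k \<ge> 2" using m k unfolding coxeter_matrix_def by metis
  then have k2: "k \<ge> 2" by (simp add: numeral_eq_enat)
  have "sin (pi / real k) > 0"
    using k2 by (intro sin_gt_zero) (auto simp: field_simps)
  moreover have "tits_coeff m s t = - cos (pi / real k)" by (simp add: tits_coeff_def k)
  ultimately show ?thesis
    using tits_refl_pair_power[OF m, of s t "pi / real k" k] k2 by (auto simp: fun_eq_iff)
qed

lemma tits_word_append: "tits_word m (u @ v) = tits_word m u \<circ> tits_word m v"
proof (induction u)
  case Nil
  show ?case by (simp add: tits_word_def)
next
  case (Cons p u)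
  then show ?case by (simp add: tits_word_def comp_assoc split: prod.split)
qed

lemma tits_word_concat_replicate: "tits_word m (concat (replicate k w)) = tits_word m w ^^ k"
proof (induction k)
  case 0
  show ?case by (simp add: tits_word_def)
next
  case (Suc k)
  then show ?case by (simp add: tits_word_append)
qed

lemma tits_word_pres_eq:
  assumes m: "coxeter_matrix m" and "pres_eq (coxeter_relators m) u v"
  shows "tits_word m u = tits_word m v"
  using assms(2)
proof (induction rule: pres_eq.induct)
  case (cancel u a b v)
  have "tits_word m [(a, b), (a, \<not> b)] = id"
    by (auto simp: tits_word_def tits_refl_inv[OF m] fun_eq_iff tits_refl_involution[OF m])
  then show ?case by (simp only: tits_word_append) simp
next
  case (relator r u v)
  then obtain s t k where r: "r = concat (replicate k [(s, True), (t, True)])" "m s t = enat k"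
    unfolding coxeter_relators_def by blast
  have "tits_word m r = id"
    unfolding r(1) tits_word_concat_replicate
    using tits_refl_pair_relation[OF m r(2)] by (simp add: tits_word_def)
  then show ?case by (simp add: tits_word_append)
qed auto

lemma tits_rep_pres_class:
  assumes m: "coxeter_matrix m"
  shows "tits_rep m (pres_class (coxeter_relators m) w) = tits_word m w"
  unfolding tits_rep_def
proof (rule the_equality)
  show "\<forall>w'\<in>pres_class (coxeter_relators m) w. tits_word m w' = tits_word m w"
    using tits_word_pres_eq[OF m] by (auto simp: pres_class_def)
  show "f = tits_word m w"
    if "\<forall>w'\<in>pres_class (coxeter_relators m) w. tits_word m w' = f" for f
    using that by (auto simp: pres_class_def intro: pres_eq.refl)
qed

lemma tits_rep_generator:
  assumes "coxeter_matrix m"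
  shows "tits_rep m (pres_class (coxeter_relators m) [(s, True)]) = tits_refl m s"
  by (simp add: tits_rep_pres_class[OF assms] tits_word_def)


section \<open>Orthogonal groups of a possibly degenerate form\<close>

definition orth_fix_group :: "('v::real_vector \<Rightarrow> 'v \<Rightarrow> real) \<Rightarrow> ('v \<Rightarrow> 'v) monoid" where
  "orth_fix_group B = (BijGroup UNIV)
    \<lparr>carrier := {f \<in> Bij UNIV. linear f \<and> (\<forall>v w. B (f v) (f w) = B v w) \<and>
                (\<forall>v\<in>form_ker B. f v = v)}\<rparr>"

lemma tits_word_orth_fix:
  assumes m: "coxeter_matrix m"
  shows "tits_word m w \<in> carrier (orth_fix_group (tits_form m))"
proof (induction w)
  case Nil
  show ?case using linear_id bij_id by (auto simp: tits_word_def orth_fix_group_def Bij_def id_def)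
next
  case (Cons p w)
  obtain s b where p: "p = (s, b)" by (cases p)
  have *: "tits_word m (p # w) = tits_refl m s \<circ> tits_word m w"
    by (simp add: p tits_word_def tits_refl_inv[OF m])
  have "bij (tits_refl m s)"
    by (rule involuntory_imp_bij) (simp add: tits_refl_involution[OF m])
  moreover have "tits_refl m s v = v" if "v \<in> form_ker (tits_form m)" for v
    using that tits_form_sym[OF m, of v] unfolding form_ker_def tits_refl_def by simp
  ultimately show ?case
    using Cons linear_tits_refl[of m s]
      bij_comp[of "tits_word m w" "tits_refl m s"] linear_compose[of "tits_word m w" "tits_refl m s"]
    unfolding * orth_fix_group_def Bij_def by (auto simp: tits_refl_preserves[OF m] o_def)
qed

lemma tits_rep_hom:
  assumes m: "coxeter_matrix m"
  shows "tits_rep m \<in> hom (coxeter_group m) (orth_fix_group (tits_form m))"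
proof (rule homI)
  fix X assume "X \<in> carrier (coxeter_group m)"
  then show "tits_rep m X \<in> carrier (orth_fix_group (tits_form m))"
    by (auto simp: coxeter_group_def presented_group_def tits_rep_pres_class[OF m]
        tits_word_orth_fix[OF m])
next
  fix X Y assume "X \<in> carrier (coxeter_group m)" "Y \<in> carrier (coxeter_group m)"
  then obtain x y where xy: "X = pres_class (coxeter_relators m) x"
      "Y = pres_class (coxeter_relators m) y"
    by (auto simp: coxeter_group_def presented_group_def)
  have "tits_word m x \<in> Bij UNIV" "tits_word m y \<in> Bij UNIV"
    using tits_word_orth_fix[OF m] by (auto simp: orth_fix_group_def)
  then show "tits_rep m (X \<otimes>\<^bsub>coxeter_group m\<^esub> Y) =
      tits_rep m X \<otimes>\<^bsub>orth_fix_group (tits_form m)\<^esub> tits_rep m Y"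
    unfolding xy coxeter_group_def pres_class_mult tits_rep_pres_class[OF m] tits_word_append
    by (auto simp: orth_fix_group_def BijGroup_def compose_def)
qed

text \<open>The quotient of \<open>'v\<close> by the kernel of \<open>B\<close>, as a set of cosets.\<close>

definition ker_coset :: "('v::real_vector \<Rightarrow> 'v \<Rightarrow> real) \<Rightarrow> 'v \<Rightarrow> 'v set" where
  "ker_coset B v = {v + k | k. k \<in> form_ker B}"

definition quot_space :: "('v::real_vector \<Rightarrow> 'v \<Rightarrow> real) \<Rightarrow> 'v set set" where
  "quot_space B = range (ker_coset B)"

definition quot_add :: "'v::real_vector set \<Rightarrow> 'v set \<Rightarrow> 'v set" where
  "quot_add X Y = {x + y | x y. x \<in> X \<and> y \<in> Y}"

text \<open>Adding the kernel makes this correct for the scalar 0 as well.\<close>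

definition quot_scale :: "('v::real_vector \<Rightarrow> 'v \<Rightarrow> real) \<Rightarrow> real \<Rightarrow> 'v set \<Rightarrow> 'v set" where
  "quot_scale B c X = {c *\<^sub>R x + k | x k. x \<in> X \<and> k \<in> form_ker B}"

definition quot_form :: "('v::real_vector \<Rightarrow> 'v \<Rightarrow> real) \<Rightarrow> 'v set \<Rightarrow> 'v set \<Rightarrow> real" where
  "quot_form B X Y = (THE b. \<forall>x\<in>X. \<forall>y\<in>Y. B x y = b)"

definition orth_group :: "('v::real_vector \<Rightarrow> 'v \<Rightarrow> real) \<Rightarrow> ('v set \<Rightarrow> 'v set) monoid" where
  "orth_group B = (BijGroup (quot_space B))
    \<lparr>carrier := {g \<in> Bij (quot_space B).
       (\<forall>X\<in>quot_space B. \<forall>Y\<in>quot_space B. g (quot_add X Y) = quot_add (g X) (g Y)) \<and>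
       (\<forall>c. \<forall>X\<in>quot_space B. g (quot_scale B c X) = quot_scale B c (g X)) \<and>
       (\<forall>X\<in>quot_space B. \<forall>Y\<in>quot_space B. quot_form B (g X) (g Y) = quot_form B X Y)}\<rparr>"

definition plus_minus_one :: "('v::real_vector \<Rightarrow> 'v \<Rightarrow> real) \<Rightarrow> ('v set \<Rightarrow> 'v set) set" where
  "plus_minus_one B = {\<lambda>X\<in>quot_space B. X, \<lambda>X\<in>quot_space B. quot_scale B (-1) X}"

definition proj_orth_group :: "('v::real_vector \<Rightarrow> 'v \<Rightarrow> real) \<Rightarrow> ('v set \<Rightarrow> 'v set) set monoid" where
  "proj_orth_group B = orth_group B Mod plus_minus_one B"

definition orth_induced :: "('v::real_vector \<Rightarrow> 'v \<Rightarrow> real) \<Rightarrow> ('v \<Rightarrow> 'v) \<Rightarrow> 'v set \<Rightarrow> 'v set" where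
  "orth_induced B f = (\<lambda>X\<in>quot_space B. f ` X)"

definition orth_to_proj ::
    "('v::real_vector \<Rightarrow> 'v \<Rightarrow> real) \<Rightarrow> ('v set \<Rightarrow> 'v set) \<Rightarrow> ('v set \<Rightarrow> 'v set) set" where
  "orth_to_proj B g = plus_minus_one B #>\<^bsub>orth_group B\<^esub> g"

definition orth_proj ::
    "('v::real_vector \<Rightarrow> 'v \<Rightarrow> real) \<Rightarrow> ('v \<Rightarrow> 'v) \<Rightarrow> ('v set \<Rightarrow> 'v set) set" where
  "orth_proj B = orth_to_proj B \<circ> orth_induced B"

lemma subspace_form_ker: "bilinear B \<Longrightarrow> subspace (form_ker B)"
  unfolding subspace_def form_ker_def
  by (auto simp: bilinear_ladd bilinear_lmul bilinear_lzero)

lemma ker_coset_eq_iff: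
  assumes B: "bilinear B"
  shows "ker_coset B v = ker_coset B w \<longleftrightarrow> v - w \<in> form_ker B"
proof
  note K = subspace_form_ker[OF B]
  assume "ker_coset B v = ker_coset B w"
  moreover have "v \<in> ker_coset B v"
    unfolding ker_coset_def using subspace_0[OF K] by force
  ultimately show "v - w \<in> form_ker B" unfolding ker_coset_def by auto
next
  note K = subspace_form_ker[OF B]
  assume vw: "v - w \<in> form_ker B"
  have "v + k = w + ((v - w) + k)" "w + k = v + (k - (v - w))" for k
    by (simp_all add: algebra_simps)
  then show "ker_coset B v = ker_coset B w"
    unfolding ker_coset_def using subspace_add[OF K vw] subspace_diff[OF K _ vw] by blast
qed

lemma ker_coset_self: "bilinear B \<Longrightarrow> v \<in> ker_coset B v"
  unfolding ker_coset_def using subspace_0[OF subspace_form_ker] by force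

lemma quot_add_coset:
  assumes B: "bilinear B"
  shows "quot_add (ker_coset B v) (ker_coset B w) = ker_coset B (v + w)"
proof
  note K = subspace_form_ker[OF B]
  have "(v + k) + (w + l) = v + w + (k + l)" for k l by simp
  then show "quot_add (ker_coset B v) (ker_coset B w) \<subseteq> ker_coset B (v + w)"
    unfolding ker_coset_def quot_add_def using subspace_add[OF K] by blast
  have "v + w + k = (v + k) + (w + 0)" for k by simp
  then show "ker_coset B (v + w) \<subseteq> quot_add (ker_coset B v) (ker_coset B w)"
    unfolding ker_coset_def quot_add_def using subspace_0[OF K] by blast
qed

lemma quot_scale_coset:
  assumes B: "bilinear B"
  shows "quot_scale B c (ker_coset B v) = ker_coset B (c *\<^sub>R v)"
proof
  note K = subspace_form_ker[OF B]
  have "c *\<^sub>R (v + k) + l = c *\<^sub>R v + (c *\<^sub>R k + l)" for k l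
    by (simp add: algebra_simps)
  then show "quot_scale B c (ker_coset B v) \<subseteq> ker_coset B (c *\<^sub>R v)"
    unfolding ker_coset_def quot_scale_def
    using subspace_add[OF K subspace_scale[OF K]] by blast
  show "ker_coset B (c *\<^sub>R v) \<subseteq> quot_scale B c (ker_coset B v)"
  proof
    fix x assume "x \<in> ker_coset B (c *\<^sub>R v)"
    then obtain k where "x = c *\<^sub>R v + k" "k \<in> form_ker B" by (auto simp: ker_coset_def)
    then show "x \<in> quot_scale B c (ker_coset B v)"
      using ker_coset_self[OF B, of v] unfolding quot_scale_def by blast
  qed
qed

lemma quot_form_coset:
  assumes B: "bilinear B" and sym: "\<And>x y. B x y = B y x"
  shows "quot_form B (ker_coset B v) (ker_coset B w) = B v w"
proof -
  have "B x y = B v w" if xy: "x \<in> ker_coset B v" "y \<in> ker_coset B w" for x y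
  proof -
    obtain k l where kl: "x = v + k" "y = w + l" "k \<in> form_ker B" "l \<in> form_ker B"
      using xy unfolding ker_coset_def by blast
    then have "B k z = 0" "B z l = 0" for z using sym unfolding form_ker_def by auto
    then show ?thesis by (simp add: kl bilinear_ladd[OF B] bilinear_radd[OF B])
  qed
  moreover have "v \<in> ker_coset B v" "w \<in> ker_coset B w" using ker_coset_self[OF B] by auto
  ultimately show ?thesis unfolding quot_form_def by (intro the_equality) (blast, metis)
qed

lemma quot_add_closed:
  assumes "bilinear B" "X \<in> quot_space B" "Y \<in> quot_space B"
  shows "quot_add X Y \<in> quot_space B"
  using assms by (auto simp: quot_space_def quot_add_coset)

lemma quot_scale_closed:
  assumes "bilinear B" "X \<in> quot_space B"
  shows "quot_scale B c X \<in> quot_space B"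
  using assms by (auto simp: quot_space_def quot_scale_coset)

lemma group_orth_group:
  assumes B: "bilinear B"
  shows "Group.group (orth_group B)"
proof -
  interpret G: Group.group "BijGroup (quot_space B)" by (rule group_BijGroup)
  let ?Q = "quot_space B"
  let ?O = "carrier (orth_group B)"
  have "subgroup ?O (BijGroup ?Q)"
  proof (rule G.subgroupI)
    show "?O \<subseteq> carrier (BijGroup ?Q)" by (auto simp: orth_group_def BijGroup_def)
    have "(\<lambda>X\<in>?Q. X) \<in> ?O"
      using quot_add_closed[OF B] quot_scale_closed[OF B]
      by (auto simp: orth_group_def BijGroup_def id_Bij)
    then show "?O \<noteq> {}" by blast
  next
    fix g assume g: "g \<in> ?O"
    then have bij: "g \<in> Bij ?Q" by (simp add: orth_group_def)
    define h where "h = restrict (inv_into ?Q g) ?Q"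
    have h: "h \<in> Bij ?Q" unfolding h_def by (rule restrict_inv_into_Bij[OF bij])
    have hQ: "h X \<in> ?Q" if "X \<in> ?Q" for X
      using h that by (auto dest: Bij_imp_funcset)
    have gh: "g (h X) = X" if "X \<in> ?Q" for X
      using bij that unfolding h_def Bij_def
      by (auto simp: bij_betw_def f_inv_into_f)
    have hg: "h (g X) = X" if "X \<in> ?Q" for X
      using bij that unfolding h_def Bij_def
      by (auto simp: bij_betw_def inv_into_f_f)
    have "h (quot_add X Y) = quot_add (h X) (h Y)" if XY: "X \<in> ?Q" "Y \<in> ?Q" for X Y
    proof -
      have "g (quot_add (h X) (h Y)) = quot_add X Y"
        using g hQ XY by (simp add: orth_group_def gh)
      then show ?thesis using hg quot_add_closed[OF B] hQ XY by metis
    qed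
    moreover have "h (quot_scale B c X) = quot_scale B c (h X)" if X: "X \<in> ?Q" for c X
    proof -
      have "g (quot_scale B c (h X)) = quot_scale B c X"
        using g hQ X by (simp add: orth_group_def gh)
      then show ?thesis using hg quot_scale_closed[OF B] hQ X by metis
    qed
    moreover have "quot_form B (h X) (h Y) = quot_form B X Y" if XY: "X \<in> ?Q" "Y \<in> ?Q" for X Y
    proof -
      have "quot_form B (g (h X)) (g (h Y)) = quot_form B (h X) (h Y)"
        using g hQ XY by (simp add: orth_group_def)
      then show ?thesis using gh XY by simp
    qed
    ultimately have "h \<in> ?O" using h by (simp add: orth_group_def)
    moreover have "inv\<^bsub>BijGroup ?Q\<^esub> g = h"
      unfolding h_def by (rule inv_BijGroup[OF bij])
    ultimately show "inv\<^bsub>BijGroup ?Q\<^esub> g \<in> ?O" by simp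
  next
    fix g h assume gh: "g \<in> ?O" "h \<in> ?O"
    then have b: "g \<in> Bij ?Q" "h \<in> Bij ?Q" by (simp_all add: orth_group_def)
    have hQ: "h X \<in> ?Q" if "X \<in> ?Q" for X
      using b that by (auto dest: Bij_imp_funcset)
    show "g \<otimes>\<^bsub>BijGroup ?Q\<^esub> h \<in> ?O"
      using gh b hQ quot_add_closed[OF B] quot_scale_closed[OF B] compose_Bij[OF b]
      by (simp add: orth_group_def BijGroup_def compose_def)
  qed
  then show ?thesis
    using G.subgroup_imp_group by (simp add: orth_group_def)
qed

lemma orth_group_mult:
  assumes "g \<in> carrier (orth_group B)" "h \<in> carrier (orth_group B)"
  shows "g \<otimes>\<^bsub>orth_group B\<^esub> h = compose (quot_space B) g h"
  using assms by (simp add: orth_group_def BijGroup_def)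

lemma one_orth_group: "\<one>\<^bsub>orth_group B\<^esub> = (\<lambda>X\<in>quot_space B. X)"
  by (simp add: orth_group_def BijGroup_def)

lemma normal_plus_minus_one:
  assumes B: "bilinear B" and sym: "\<And>x y. B x y = B y x"
  shows "plus_minus_one B \<lhd> orth_group B"
proof -
  interpret G: Group.group "orth_group B" by (rule group_orth_group[OF B])
  let ?Q = "quot_space B"
  let ?O = "carrier (orth_group B)"
  define n where "n = (\<lambda>X\<in>?Q. quot_scale B (-1) X)"
  have nn: "n (n X) = X" and nQ: "n X \<in> ?Q" if "X \<in> ?Q" for X
    using that quot_scale_closed[OF B] unfolding n_def
    by (auto simp: quot_space_def quot_scale_coset[OF B])
  have bij: "n \<in> Bij ?Q"
    unfolding Bij_def using nn nQ
    by (auto intro!: bij_betw_byWitness[where f' = n]) (simp add: n_def)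
  have n: "n \<in> ?O"
    using bij unfolding orth_group_def
    by (auto simp: n_def quot_space_def quot_add_coset[OF B] quot_scale_coset[OF B]
        quot_form_coset[OF B sym] bilinear_lneg[OF B] bilinear_rneg[OF B])
  have nsq: "n \<otimes>\<^bsub>orth_group B\<^esub> n = \<one>\<^bsub>orth_group B\<^esub>"
    unfolding orth_group_mult[OF n n] one_orth_group compose_def by (rule restrict_ext) (rule nn)
  then have ninv: "inv\<^bsub>orth_group B\<^esub> n = n" using n by (simp add: G.inv_equality)
  have N: "plus_minus_one B = {\<one>\<^bsub>orth_group B\<^esub>, n}"
    by (simp add: plus_minus_one_def one_orth_group n_def)
  have "subgroup (plus_minus_one B) (orth_group B)"
    unfolding N by (rule G.subgroupI) (use n nsq ninv in auto)
  moreover have "g \<otimes>\<^bsub>orth_group B\<^esub> n \<otimes>\<^bsub>orth_group B\<^esub> inv\<^bsub>orth_group B\<^esub> g = n" if g: "g \<in> ?O" for g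
  proof -
    have gQ: "g X \<in> ?Q" if "X \<in> ?Q" for X
      using g that by (auto simp: orth_group_def dest: Bij_imp_funcset)
    have gs: "g (quot_scale B (-1) X) = quot_scale B (-1) (g X)" if "X \<in> ?Q" for X
      using g that by (simp add: orth_group_def)
    have "g \<otimes>\<^bsub>orth_group B\<^esub> n = n \<otimes>\<^bsub>orth_group B\<^esub> g"
      unfolding orth_group_mult[OF g n] orth_group_mult[OF n g] compose_def
      by (rule restrict_ext) (simp add: n_def gs gQ)
    then show ?thesis using g n by (simp add: G.m_assoc)
  qed
  ultimately show ?thesis unfolding G.normal_inv_iff N by auto
qed

lemma orth_induced_hom:
  assumes B: "bilinear B" and sym: "\<And>x y. B x y = B y x"
  shows "orth_induced B \<in> hom (orth_fix_group B) (orth_group B)"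
proof (rule homI)
  let ?Q = "quot_space B"
  have coset: "orth_induced B f (ker_coset B v) = ker_coset B (f v)"
    if f: "f \<in> carrier (orth_fix_group B)" for f v
  proof -
    have "f (v + k) = f v + k" if "k \<in> form_ker B" for k
      using f that by (simp add: orth_fix_group_def linear_add)
    then have "f ` ker_coset B v = ker_coset B (f v)"
      unfolding ker_coset_def by (auto simp: image_iff) metis+
    then show ?thesis by (simp add: orth_induced_def quot_space_def)
  qed
  show "orth_induced B f \<in> carrier (orth_group B)"
    if f: "f \<in> carrier (orth_fix_group B)" for f
  proof -
    have bij: "bij f" and lin: "linear f" and pres: "B (f v) (f w) = B v w" for v w
      using f by (auto simp: orth_fix_group_def Bij_def)
    have surj: "\<exists>v. w = f v" for w using bij by (auto simp: bij_def surj_def)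
    have "bij_betw (orth_induced B f) ?Q ?Q"
    proof (rule bij_betwI')
      fix X Y assume "X \<in> ?Q" "Y \<in> ?Q"
      then obtain v w where vw: "X = ker_coset B v" "Y = ker_coset B w"
        by (auto simp: quot_space_def)
      have "f v - f w \<in> form_ker B \<longleftrightarrow> v - w \<in> form_ker B"
      proof -
        have "B (f v - f w) (f u) = B (v - w) u" for u
          using pres[of "v - w" u] by (simp add: linear_diff[OF lin])
        then have "(\<forall>u. B (f v - f w) (f u) = 0) \<longleftrightarrow> v - w \<in> form_ker B"
          by (simp add: form_ker_def)
        moreover have "(\<forall>u. B (f v - f w) (f u) = 0) \<longleftrightarrow> f v - f w \<in> form_ker B"
        proof
          assume "\<forall>u. B (f v - f w) (f u) = 0"
          then have "B (f v - f w) u = 0" for u using surj[of u] by auto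
          then show "f v - f w \<in> form_ker B" by (simp add: form_ker_def)
        qed (simp add: form_ker_def)
        ultimately show ?thesis by blast
      qed
      then show "(orth_induced B f X = orth_induced B f Y) = (X = Y)"
        unfolding vw coset[OF f] ker_coset_eq_iff[OF B] .
    next
      fix X assume "X \<in> ?Q"
      then show "orth_induced B f X \<in> ?Q" by (auto simp: quot_space_def coset[OF f])
    next
      fix Y assume "Y \<in> ?Q"
      then obtain w where w: "Y = ker_coset B w" by (auto simp: quot_space_def)
      obtain v where "w = f v" using surj by blast
      then have "Y = orth_induced B f (ker_coset B v)" by (simp add: w coset[OF f])
      then show "\<exists>X\<in>?Q. Y = orth_induced B f X" by (auto simp: quot_space_def)
    qed
    moreover have "orth_induced B f \<in> extensional ?Q" by (simp add: orth_induced_def)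
    ultimately have "orth_induced B f \<in> Bij ?Q" by (simp add: Bij_def)
    then show ?thesis
      by (auto simp: orth_group_def quot_space_def quot_add_coset[OF B] quot_scale_coset[OF B]
          quot_form_coset[OF B sym] coset[OF f] linear_add[OF lin] linear_scale[OF lin] pres)
  qed
  then show "orth_induced B (f \<otimes>\<^bsub>orth_fix_group B\<^esub> g) =
      orth_induced B f \<otimes>\<^bsub>orth_group B\<^esub> orth_induced B g"
    if f: "f \<in> carrier (orth_fix_group B)" and g: "g \<in> carrier (orth_fix_group B)" for f g
  proof -
    have "orth_induced B g X \<in> ?Q" if "X \<in> ?Q" for X
      using that by (auto simp: quot_space_def coset[OF g])
    then show ?thesis
      using f g \<open>\<And>f. f \<in> carrier (orth_fix_group B) \<Longrightarrow> orth_induced B f \<in> carrier (orth_group B)\<close>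
      by (auto simp: orth_group_mult orth_fix_group_def BijGroup_def compose_def orth_induced_def
          image_comp fun_eq_iff o_def)
  qed
qed

lemma group_proj_orth_group:
  assumes "bilinear B" "\<And>x y. B x y = B y x"
  shows "Group.group (proj_orth_group B)"
  unfolding proj_orth_group_def by (rule normal.factorgroup_is_group[OF normal_plus_minus_one[OF assms]])

lemma orth_proj_hom:
  assumes "bilinear B" "\<And>x y. B x y = B y x"
  shows "orth_proj B \<in> hom (orth_fix_group B) (proj_orth_group B)"
proof -
  have "orth_to_proj B \<in> hom (orth_group B) (proj_orth_group B)"
    unfolding proj_orth_group_def orth_to_proj_def
    by (rule normal.r_coset_hom_Mod[OF normal_plus_minus_one[OF assms]])
  then show ?thesis
    unfolding orth_proj_def by (rule hom_compose[OF orth_induced_hom[OF assms]])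
qed


section \<open>Ordinary and Zariski topology on the projective orthogonal group\<close>

definition quot_dual :: "('v::real_vector \<Rightarrow> 'v \<Rightarrow> real) \<Rightarrow> ('v set \<Rightarrow> real) set" where
  "quot_dual B = {\<phi>.
     (\<forall>X\<in>quot_space B. \<forall>Y\<in>quot_space B. \<phi> (quot_add X Y) = \<phi> X + \<phi> Y) \<and>
     (\<forall>c. \<forall>X\<in>quot_space B. \<phi> (quot_scale B c X) = c * \<phi> X)}"

text \<open>The functions \<open>\<lambda>g. \<phi> (g X)\<close>, with \<open>\<phi>\<close> a linear functional on the quotient space and \<open>X\<close> one of
  its vectors, span the linear functionals on its endomorphism algebra. They generate the usual
  topology and the algebra of polynomial functions; the quotient by \<open>\<plusminus>1\<close> carries the quotient topology
  and has as coordinate ring the polynomial functions invariant under \<open>\<plusminus>1\<close>.\<close>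

definition orth_topology :: "('v::real_vector \<Rightarrow> 'v \<Rightarrow> real) \<Rightarrow> ('v set \<Rightarrow> 'v set) topology" where
  "orth_topology B = topology_generated_by
    {{g \<in> carrier (orth_group B). \<phi> (g X) \<in> U} | \<phi> X U.
       \<phi> \<in> quot_dual B \<and> X \<in> quot_space B \<and> open U}"

definition proj_orth_topology ::
    "('v::real_vector \<Rightarrow> 'v \<Rightarrow> real) \<Rightarrow> ('v set \<Rightarrow> 'v set) set topology" where
  "proj_orth_topology B = topology (\<lambda>U. U \<subseteq> carrier (proj_orth_group B) \<and>
     openin (orth_topology B) {g \<in> carrier (orth_group B). orth_to_proj B g \<in> U})"

lemma openin_proj_orth_topology:
  "openin (proj_orth_topology B) U \<longleftrightarrow> U \<subseteq> carrier (proj_orth_group B) \<and>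
     openin (orth_topology B) {g \<in> carrier (orth_group B). orth_to_proj B g \<in> U}"
proof -
  let ?pre = "\<lambda>U. {g \<in> carrier (orth_group B). orth_to_proj B g \<in> U}"
  have "?pre (U \<inter> V) = ?pre U \<inter> ?pre V" for U V by blast
  moreover have "?pre (\<Union>\<U>) = \<Union>(?pre ` \<U>)" for \<U> by blast
  ultimately have "istopology (\<lambda>U. U \<subseteq> carrier (proj_orth_group B) \<and>
      openin (orth_topology B) (?pre U))"
    unfolding istopology_def by (auto intro!: openin_Int openin_Union)
  then show ?thesis unfolding proj_orth_topology_def by (simp add: topology_inverse')
qed

inductive orth_poly ::
    "('v::real_vector \<Rightarrow> 'v \<Rightarrow> real) \<Rightarrow> (('v set \<Rightarrow> 'v set) \<Rightarrow> real) \<Rightarrow> bool" for B where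
  coeff: "\<phi> \<in> quot_dual B \<Longrightarrow> X \<in> quot_space B \<Longrightarrow> orth_poly B (\<lambda>g. \<phi> (g X))"
| const: "orth_poly B (\<lambda>g. c)"
| add: "orth_poly B p \<Longrightarrow> orth_poly B q \<Longrightarrow> orth_poly B (\<lambda>g. p g + q g)"
| mult: "orth_poly B p \<Longrightarrow> orth_poly B q \<Longrightarrow> orth_poly B (\<lambda>g. p g * q g)"

definition proj_orth_regular ::
    "('v::real_vector \<Rightarrow> 'v \<Rightarrow> real) \<Rightarrow> (('v set \<Rightarrow> 'v set) set \<Rightarrow> real) \<Rightarrow> bool" where
  "proj_orth_regular B F \<longleftrightarrow>
    (\<exists>p. orth_poly B p \<and> (\<forall>g\<in>carrier (orth_group B). F (orth_to_proj B g) = p g))"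

definition zariski_closed ::
    "('v::real_vector \<Rightarrow> 'v \<Rightarrow> real) \<Rightarrow> ('v set \<Rightarrow> 'v set) set set \<Rightarrow> bool" where
  "zariski_closed B Z \<longleftrightarrow> (\<exists>P. (\<forall>F\<in>P. proj_orth_regular B F) \<and>
    Z = {x \<in> carrier (proj_orth_group B). \<forall>F\<in>P. F x = 0})"

definition zariski_dense ::
    "('v::real_vector \<Rightarrow> 'v \<Rightarrow> real) \<Rightarrow> ('v set \<Rightarrow> 'v set) set set \<Rightarrow> bool" where
  "zariski_dense B H \<longleftrightarrow>
    \<Inter>{Z. zariski_closed B Z \<and> H \<subseteq> Z} = carrier (proj_orth_group B)"

end

theory Submission
  imports Defs
begin

text \<open>
  Write \<open>V = \<real>\<^sup>S\<close>. By Perron--Frobenius, the lowest eigenvalue \<open>\<mu>\<close> of the Tits form \<open>B\<close> of a non-affine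
  group is negative and belongs to a vector \<open>u\<close> with positive coordinates. By Tits' theorem every root
  \<open>w e\<^sub>s\<close> is non-negative or non-positive, and \<open>w = 1\<close> if all of them are non-negative. As
  \<open>B(u, \<cdot>) = \<mu> u \<bullet> \<cdot>\<close>, the element \<open>w\<close> is trivial as soon as \<open>B(u, w e\<^sub>s) < 0\<close> for all \<open>s\<close>, whereas
  \<open>B(u, w e\<^sub>s) > 0\<close> for all \<open>s\<close> is impossible because \<open>w u \<ge> u\<close>. The values \<open>B(u, w e\<^sub>s)\<close> depend only on
  the action modulo \<open>Ker B\<close>, so this open condition gives both injectivity and discreteness in
  \<open>PO\<close>.

  For Zariski density, let \<open>R\<close> be the set of vectors whose reflection lies in the Zariski closure of
  \<open>W\<close> in \<open>End V\<close>. If infinitely many points of an affine line are in \<open>R\<close>, then the whole line is. Hence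
  \<open>R\<close> contains every plane spanned by two of its vectors on which \<open>B\<close> is indefinite (with a
  non-degenerate restriction), such a plane exists since \<open>u \<bullet> w u\<close> is unbounded, and a subspace of
  \<open>R\<close> of maximal dimension containing a negative vector is everything by irreducibility. Finally,
  reflections generate the orthogonal group of \<open>V / Ker B\<close>.
\<close>

subsection \<open>Reduced words and positivity of roots\<close>

abbreviation letters :: "'s list \<Rightarrow> 's word" where
  "letters \<equiv> map (\<lambda>s. (s, True))"

text \<open>Lists of generators suffice because every generator is an involution; the inverse of a
  word is then its reversal.\<close>

definition cox_eq :: "('s \<Rightarrow> 's \<Rightarrow> enat) \<Rightarrow> 's list \<Rightarrow> 's list \<Rightarrow> bool" where
  "cox_eq m u v \<longleftrightarrow> pres_eq (coxeter_relators m) (letters u) (letters v)"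

lemma cox_eq_refl [simp]: "cox_eq m u u"
  by (simp add: cox_eq_def pres_eq.refl)

lemma cox_eq_sym: "cox_eq m u v \<Longrightarrow> cox_eq m v u"
  unfolding cox_eq_def by (rule pres_eq.sym)

lemma cox_eq_trans [trans]: "cox_eq m u v \<Longrightarrow> cox_eq m v w \<Longrightarrow> cox_eq m u w"
  unfolding cox_eq_def by (rule pres_eq.trans)

lemma cox_eq_append: "cox_eq m u v \<Longrightarrow> cox_eq m x y \<Longrightarrow> cox_eq m (u @ x) (v @ y)"
  by (simp add: cox_eq_def pres_eq_append)

lemma cox_eq_square:
  assumes "coxeter_matrix m"
  shows "cox_eq m (u @ s # s # v) (u @ v)"
proof -
  have "[(s, True), (s, True)] = concat (replicate 1 [(s, True), (s, True)])" by simp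
  moreover have "m s s = enat 1" using assms by (simp add: coxeter_matrix_def one_enat_def)
  ultimately have "[(s, True), (s, True)] \<in> coxeter_relators m"
    unfolding coxeter_relators_def by blast
  from pres_eq.relator[OF this, of "letters u" "letters v"] show ?thesis
    by (simp add: cox_eq_def)
qed

lemma cox_eq_append_rev:
  assumes "coxeter_matrix m"
  shows "cox_eq m (u @ rev u) []"
proof (induction u rule: rev_induct)
  case (snoc s u)
  have "cox_eq m (u @ s # s # rev u) (u @ rev u)" by (rule cox_eq_square[OF assms])
  then show ?case using snoc cox_eq_trans by fastforce
qed simp

lemma cox_eq_rev_append:
  assumes "coxeter_matrix m"
  shows "cox_eq m (rev u @ u) []"
  using cox_eq_append_rev[OF assms, of "rev u"] by simp

lemma cox_eq_cancel_left:
  assumes m: "coxeter_matrix m" and "cox_eq m (u @ v) w"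
  shows "cox_eq m v (rev u @ w)"
proof -
  have "cox_eq m ((rev u @ u) @ v) ([] @ v)"
    by (intro cox_eq_append cox_eq_rev_append m cox_eq_refl)
  moreover have "cox_eq m (rev u @ (u @ v)) (rev u @ w)"
    by (intro cox_eq_append assms cox_eq_refl)
  ultimately show ?thesis by (metis append.assoc append_Nil cox_eq_sym cox_eq_trans)
qed

lemma pres_eq_letters:
  assumes m: "coxeter_matrix m"
  shows "pres_eq (coxeter_relators m) w (letters (map fst w))"
proof (induction w)
  case Nil
  show ?case by (simp add: pres_eq.refl)
next
  case (Cons p w)
  obtain s b where p: "p = (s, b)" by (cases p)
  have "pres_eq (coxeter_relators m) [(s, b)] [(s, True)]"
  proof (cases b)
    case False
    have "pres_eq (coxeter_relators m) ([(s, False)] @ letters [s, s]) ([(s, False)] @ letters [])"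
      using cox_eq_square[OF m, of "[]" s "[]"] unfolding cox_eq_def
      by (intro pres_eq_append_left) simp
    moreover have "pres_eq (coxeter_relators m) ([] @ [(s, False), (s, \<not> False)] @ [(s, True)])
        ([] @ [(s, True)])"
      by (rule pres_eq.cancel)
    ultimately show ?thesis using False by (auto intro: pres_eq.sym pres_eq.trans)
  qed (simp add: pres_eq.refl)
  from pres_eq_append[OF this Cons] show ?case by (simp add: p)
qed

text \<open>Relators have even length and a cancellation removes two letters. This is the sign
  character of \<open>W\<close>.\<close>

lemma pres_eq_even_length:
  assumes "pres_eq (coxeter_relators m) u v"
  shows "even (length u) \<longleftrightarrow> even (length v)"
  using assms
proof (induction rule: pres_eq.induct)
  case (relator r u v)
  have "length (concat (replicate k [x, y])) = 2 * k" for k and x y :: "'a \<times> bool"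
    by (induction k) auto
  then have "even (length r)" using relator unfolding coxeter_relators_def by auto
  then show ?case by simp
qed auto

lemma cox_eq_even_length: "cox_eq m u v \<Longrightarrow> even (length u) \<longleftrightarrow> even (length v)"
  unfolding cox_eq_def using pres_eq_even_length by fastforce

definition reduced :: "('s \<Rightarrow> 's \<Rightarrow> enat) \<Rightarrow> 's list \<Rightarrow> bool" where
  "reduced m u \<longleftrightarrow> (\<forall>v. cox_eq m u v \<longrightarrow> length u \<le> length v)"

lemma reduced_Nil [simp]: "reduced m []"
  by (simp add: reduced_def)

lemma ex_reduced: "\<exists>v. cox_eq m u v \<and> reduced m v"
proof -
  obtain v where "cox_eq m u v" "\<forall>w. cox_eq m u w \<longrightarrow> length v \<le> length w"
    using ex_has_least_nat[of "cox_eq m u" u length] by auto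
  then show ?thesis unfolding reduced_def using cox_eq_trans by blast
qed

lemma reduced_cox_eq:
  assumes "reduced m u" "cox_eq m u v" "length v = length u"
  shows "reduced m v"
  using assms unfolding reduced_def by (metis cox_eq_trans)

lemma reduced_appendD:
  assumes "reduced m (u @ v)"
  shows "reduced m u" "reduced m v"
proof -
  have "length u \<le> length w" if "cox_eq m u w" for w
    using assms cox_eq_append[OF that cox_eq_refl[of m v]] unfolding reduced_def by fastforce
  then show "reduced m u" by (simp add: reduced_def)
  have "length v \<le> length w" if "cox_eq m v w" for w
    using assms cox_eq_append[OF cox_eq_refl[of m u] that] unfolding reduced_def by fastforce
  then show "reduced m v" by (simp add: reduced_def)
qed

lemma not_reduced_square: "coxeter_matrix m \<Longrightarrow> \<not> reduced m [s, s]"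
  using cox_eq_square[of m "[]" s "[]"] by (auto simp: reduced_def)

text \<open>By parity, right multiplication by \<open>s\<close> cannot preserve length. So a shorter
  word for \<open>w @ [s]\<close> is already shorter than \<open>w\<close>, and appending
  \<open>s\<close> to it gives back \<open>w\<close>.\<close>

lemma not_reduced_snoc:
  assumes m: "coxeter_matrix m" and red: "reduced m w" and nred: "\<not> reduced m (w @ [s])"
  obtains w' where "cox_eq m w (w' @ [s])" "length w = Suc (length w')"
proof -
  obtain v where v: "cox_eq m (w @ [s]) v" "length v < Suc (length w)"
    using nred unfolding reduced_def by fastforce
  have "even (length v) \<noteq> even (length w)"
    using cox_eq_even_length[OF v(1)] by simp
  then have less: "length v < length w" using v(2) by (metis less_antisym)
  have "cox_eq m (w @ s # s # []) (w @ [])" by (rule cox_eq_square[OF m])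
  moreover have "cox_eq m ((w @ [s]) @ [s]) (v @ [s])"
    by (intro cox_eq_append v cox_eq_refl)
  ultimately have eq: "cox_eq m w (v @ [s])"
    using cox_eq_trans cox_eq_sym by fastforce
  then have "length w \<le> Suc (length v)" using red unfolding reduced_def by fastforce
  then show ?thesis using that[OF eq] less by simp
qed

text \<open>The alternating word of length \<open>k\<close> in \<open>s, t\<close> whose last letter is \<open>t\<close>.\<close>

fun altw :: "nat \<Rightarrow> 's \<Rightarrow> 's \<Rightarrow> 's list" where
  "altw 0 s t = []"
| "altw (Suc k) s t = altw k t s @ [t]"

lemma length_altw [simp]: "length (altw k s t) = k"
  by (induction k arbitrary: s t) auto

lemma altw_add:
  "altw (i + j) s t = altw j (if even i then s else t) (if even i then t else s) @ altw i s t"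
  by (induction i arbitrary: s t) auto

lemma altw_even: "altw (2 * k) s t = concat (replicate k [s, t])"
proof (induction k)
  case (Suc k)
  have "concat (replicate (Suc k) [s, t]) = concat (replicate k [s, t]) @ [s, t]"
    by (simp only: replicate_append_same[symmetric] replicate_Suc) simp
  then show ?case using Suc by simp
qed simp

text \<open>The relation \<open>(s t)^k = 1\<close> cuts the alternating word of length
  \<open>2 * k\<close> into a suffix of length \<open>Suc k\<close> and a prefix \<open>c\<close> of
  length \<open>k - 1\<close>; the suffix therefore equals the shorter word
  \<open>rev c\<close>.\<close>

lemma not_reduced_altw:
  assumes m: "coxeter_matrix m" and k: "m s t = enat k" and st: "s \<noteq> t" and n: "k < n"
  shows "\<not> reduced m (altw n s t)"
proof
  assume red: "reduced m (altw n s t)"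
  have "altw n s t = altw (Suc k + (n - Suc k)) s t" using n by simp
  then have red: "reduced m (altw (Suc k) s t)"
    using red unfolding altw_add by (metis reduced_appendD(2))
  have "enat k \<ge> 2" using m k st unfolding coxeter_matrix_def by metis
  then have k2: "k \<ge> 2" by (simp add: numeral_eq_enat)
  define c where "c = altw (k - 1) (if even (Suc k) then s else t) (if even (Suc k) then t else s)"
  have "altw (2 * k) s t = altw (Suc k + (k - 1)) s t" using k2 by (simp add: mult_2)
  then have c: "altw (2 * k) s t = c @ altw (Suc k) s t"
    unfolding altw_add c_def .
  have "letters (altw (2 * k) s t) = concat (replicate k [(s, True), (t, True)])"
    by (simp add: altw_even map_concat)
  then have "letters (altw (2 * k) s t) \<in> coxeter_relators m"
    using k unfolding coxeter_relators_def by blast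
  from pres_eq.relator[OF this, of "[]" "[]"] have "cox_eq m (c @ altw (Suc k) s t) []"
    by (simp add: cox_eq_def c)
  then have "cox_eq m (altw (Suc k) s t) (rev c @ [])" by (rule cox_eq_cancel_left[OF m])
  then have "Suc k \<le> length c" using red unfolding reduced_def by fastforce
  then show False by (simp add: c_def)
qed

text \<open>A reduced word never repeats a letter in succession, so with only two letters it must
  alternate. The induction swaps \<open>s\<close> and \<open>t\<close> at each removed
  letter.\<close>

lemma reduced_dihedral_altw:
  assumes m: "coxeter_matrix m"
  shows "reduced m d \<Longrightarrow> set d \<subseteq> {s, t} \<Longrightarrow> d = [] \<or> last d = t \<Longrightarrow> d = altw (length d) s t"
proof (induction d arbitrary: s t rule: rev_induct)
  case (snoc x d)
  have x: "x = t" using snoc by simp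
  have "d = [] \<or> last d = s"
  proof (rule ccontr)
    assume d: "\<not> ?thesis"
    then have "last d \<in> set (d @ [x])" by simp
    then have "last d \<in> {s, t}" using snoc.prems(2) by blast
    then have "last d = t" using d by blast
    then have "d @ [x] = butlast d @ [t, t]" using d x append_butlast_last_id[of d] by simp
    then have "reduced m [t, t]" using snoc.prems(1) reduced_appendD(2) by metis
    then show False using not_reduced_square[OF m] by blast
  qed
  then have "d = altw (length d) t s"
    using snoc.IH[of t s] snoc.prems reduced_appendD(1) by auto
  then show ?case using x by simp
qed simp

section \<open>The linear action of words and their effect on simple roots\<close>

definition act :: "('s::finite \<Rightarrow> 's \<Rightarrow> enat) \<Rightarrow> 's list \<Rightarrow> real ^ 's \<Rightarrow> real ^ 's" where
  "act m w = tits_word m (letters w)"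

lemma act_append: "act m (u @ v) x = act m u (act m v x)"
  by (simp add: act_def tits_word_append)

lemma act_Nil [simp]: "act m [] x = x"
  by (simp add: act_def tits_word_def)

lemma id_range_act: "id \<in> range (act m)"
  using act_Nil by (metis eq_id_iff rangeI)

lemma comp_range_act:
  assumes "g \<in> range (act m)" "h \<in> range (act m)"
  shows "g \<circ> h \<in> range (act m)"
proof -
  obtain v w where "g = act m v" "h = act m w" using assms by blast
  then have "g \<circ> h = act m (v @ w)" by (simp add: fun_eq_iff act_append)
  then show ?thesis by blast
qed

lemma act_Cons: "act m (s # w) x = tits_refl m s (act m w x)"
  by (simp add: act_def tits_word_def)

lemma act_cox_eq: "coxeter_matrix m \<Longrightarrow> cox_eq m u v \<Longrightarrow> act m u = act m v"
  unfolding cox_eq_def act_def by (rule tits_word_pres_eq)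

lemma linear_act: "linear (act m w)"
proof (induction w)
  case Nil
  show ?case using linear_id by (simp add: act_def tits_word_def id_def)
next
  case (Cons s w)
  have "act m (s # w) = tits_refl m s \<circ> act m w" by (simp add: fun_eq_iff act_Cons)
  then show ?case using linear_compose[OF Cons linear_tits_refl] by (simp only:)
qed

lemma form_act:
  assumes "coxeter_matrix m"
  shows "tits_form m (act m w x) (act m w y) = tits_form m x y"
  using tits_word_orth_fix[OF assms] by (simp add: act_def orth_fix_group_def)

lemma tits_refl_axis: "coxeter_matrix m \<Longrightarrow> tits_refl m s (axis s 1) = - axis s 1"
  by (simp add: tits_refl_def tits_coeff_diag scaleR_2)

lemma act_snoc_axis:
  assumes "coxeter_matrix m"
  shows "act m (w @ [s]) (axis s 1) = - act m w (axis s 1)"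
  by (simp add: act_append act_Cons tits_refl_axis[OF assms] linear_neg[OF linear_act])

text \<open>Chebyshev-type coefficients: \<open>U k = sin (k \<theta>) / sin \<theta>\<close> with \<open>\<theta> = \<pi> / m s t\<close>, and \<open>U k = k\<close>
  in the limit case \<open>m s t = \<infinity>\<close>.\<close>

lemma dihedral_coeffs:
  assumes m: "coxeter_matrix m" and st: "s \<noteq> t"
  obtains U :: "nat \<Rightarrow> real" where "U 0 = 0" "U 1 = 1"
    "\<And>k. U (Suc (Suc k)) = - 2 * tits_coeff m s t * U (Suc k) - U k"
    "\<And>k. enat k \<le> m s t \<Longrightarrow> U k \<ge> 0"
proof (cases "m s t")
  case infinity
  show ?thesis
    by (rule that[of real]) (simp_all add: tits_coeff_def infinity)
next
  case (enat k)
  have "enat k \<ge> 2" using m enat st unfolding coxeter_matrix_def by metis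
  then have k2: "k \<ge> 2" by (simp add: numeral_eq_enat)
  define \<theta> where "\<theta> = pi / real k"
  have pos: "sin \<theta> > 0"
    unfolding \<theta>_def using k2 by (intro sin_gt_zero) (auto simp: field_simps)
  show ?thesis
  proof (rule that[of "\<lambda>i. sin (real i * \<theta>) / sin \<theta>"])
    fix i
    have "sin (real i * \<theta> + \<theta> + \<theta>) = 2 * cos \<theta> * sin (real i * \<theta> + \<theta>) - sin (real i * \<theta>)"
      using sin_add[of "real i * \<theta> + \<theta>" \<theta>] sin_diff[of "real i * \<theta> + \<theta>" \<theta>] by simp
    then show "sin (real (Suc (Suc i)) * \<theta>) / sin \<theta> =
        - 2 * tits_coeff m s t * (sin (real (Suc i) * \<theta>) / sin \<theta>) - sin (real i * \<theta>) / sin \<theta>"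
      by (simp add: tits_coeff_def enat \<theta>_def[symmetric] distrib_right add.assoc add.commute
          diff_divide_distrib)
  next
    fix i assume "enat i \<le> m s t"
    then have "i \<le> k" by (simp add: enat)
    then have "real i * \<theta> \<le> pi" using k2 by (simp add: \<theta>_def field_simps)
    then have "sin (real i * \<theta>) \<ge> 0"
      using k2 by (intro sin_ge_zero) (simp_all add: \<theta>_def)
    then show "sin (real i * \<theta>) / sin \<theta> \<ge> 0" using pos by simp
  qed (use pos in simp_all)
qed

text \<open>Removing the last letter \<open>y\<close> turns \<open>axis x 1\<close> into a
  combination of \<open>axis x 1\<close> and \<open>axis y 1\<close>. The second is covered by
  induction with the letters exchanged; for the first, the preceding letter \<open>x\<close> only
  flips the sign, which goes back two steps. The recurrence for \<open>U\<close> then combines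
  both.\<close>

lemma act_altw_axis:
  assumes m: "coxeter_matrix m"
    and U: "U 0 = 0" "U 1 = 1" "\<And>k. U (Suc (Suc k)) = - 2 * tits_coeff m s t * U (Suc k) - U k"
  shows "{x, y} = {s, t} \<Longrightarrow> act m (altw k x y) (axis x 1) =
    (if even k then U (Suc k) *\<^sub>R axis x 1 + U k *\<^sub>R axis y 1
     else U k *\<^sub>R axis x 1 + U (Suc k) *\<^sub>R axis y 1)"
proof (induction k arbitrary: x y rule: less_induct)
  case (less k)
  have c: "tits_coeff m y x = tits_coeff m s t"
    using less.prems m unfolding coxeter_matrix_def tits_coeff_def
    by (auto simp: doubleton_eq_iff)
  have r: "tits_refl m y (axis x 1) = axis x 1 - (2 * tits_coeff m s t) *\<^sub>R axis y 1"
    by (simp add: tits_refl_def c)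
  show ?case
  proof (cases k)
    case 0
    then show ?thesis using U by simp
  next
    case (Suc j)
    have yx: "{y, x} = {s, t}" using less.prems by blast
    have *: "act m (altw k x y) (axis x 1) =
        act m (altw j y x) (axis x 1) - (2 * tits_coeff m s t) *\<^sub>R act m (altw j y x) (axis y 1)"
      by (simp add: Suc act_append act_Cons r linear_diff[OF linear_act] linear_scale[OF linear_act])
    have IHj: "act m (altw j y x) (axis y 1) =
        (if even j then U (Suc j) *\<^sub>R axis y 1 + U j *\<^sub>R axis x 1
         else U j *\<^sub>R axis y 1 + U (Suc j) *\<^sub>R axis x 1)"
      using less.IH[of j y x] Suc yx by simp
    show ?thesis
    proof (cases j)
      case 0
      then show ?thesis using * U Suc U(3)[of 0] by (simp add: r act_Cons algebra_simps)
    next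
      case (Suc i)
      have "act m (altw j y x) (axis x 1) = - act m (altw i x y) (axis x 1)"
        by (simp add: Suc act_snoc_axis[OF m])
      moreover have "act m (altw i x y) (axis x 1) =
          (if even i then U (Suc i) *\<^sub>R axis x 1 + U i *\<^sub>R axis y 1
           else U i *\<^sub>R axis x 1 + U (Suc i) *\<^sub>R axis y 1)"
        using less.IH[of i x y] \<open>k = Suc j\<close> Suc less.prems by simp
      ultimately have act: "act m (altw k x y) (axis x 1) =
          - (if even i then U j *\<^sub>R axis x 1 + U i *\<^sub>R axis y 1
             else U i *\<^sub>R axis x 1 + U j *\<^sub>R axis y 1)
          - (2 * tits_coeff m s t) *\<^sub>R (if even j then U k *\<^sub>R axis y 1 + U j *\<^sub>R axis x 1
             else U j *\<^sub>R axis y 1 + U k *\<^sub>R axis x 1)"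
        using * IHj by (simp only: Suc[symmetric] \<open>k = Suc j\<close>[symmetric])
      have rec: "U (Suc k) = - 2 * tits_coeff m s t * U k - U j"
        "U k = - 2 * tits_coeff m s t * U j - U i"
        using U(3)[of j] U(3)[of i] \<open>k = Suc j\<close> Suc by simp_all
      have par: "even k \<longleftrightarrow> even i" "even j \<longleftrightarrow> odd i" using \<open>k = Suc j\<close> Suc by simp_all
      show ?thesis
        unfolding act par rec by (cases "even i") (simp_all add: algebra_simps)
    qed
  qed
qed

text \<open>Tits' positivity theorem. The last letters of \<open>w\<close> that lie in a common dihedral parabolic
  subgroup with \<open>s\<close> are split off; the dihedral part is then computed explicitly.\<close>

lemma reduced_snoc_nonneg:
  assumes m: "coxeter_matrix m"
  shows "reduced m (w @ [s]) \<Longrightarrow> act m w (axis s 1) $ i \<ge> 0"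
proof (induction "length w" arbitrary: w s rule: less_induct)
  case less
  show ?case
  proof (cases w rule: rev_cases)
    case Nil
    then show ?thesis by (simp add: axis_def)
  next
    case (snoc w0 t)
    have red: "reduced m w" using less.prems by (rule reduced_appendD)
    have "t \<noteq> s"
    proof
      assume "t = s"
      then have "reduced m (w0 @ [s, s])" using less.prems snoc by simp
      then show False using not_reduced_square[OF m] reduced_appendD(2) by blast
    qed
    \<comment> \<open>Among length-additive factorizations with \<open>d\<close> in the dihedral
      subgroup of \<open>s\<close> and \<open>t\<close>, one with shortest \<open>v\<close> makes
      \<open>v\<close> the minimal representative of its coset.\<close>
    define Q where "Q = (\<lambda>(v, d). cox_eq m w (v @ d) \<and> length w = length v + length d \<and> set d \<subseteq> {s, t})"
    have "Q (w0, [t])" by (simp add: Q_def snoc)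
    from ex_has_least_nat[of Q, OF this, of "length \<circ> fst"]
    obtain v d where vd: "Q (v, d)" and min: "\<And>v' d'. Q (v', d') \<Longrightarrow> length v \<le> length v'"
      by fastforce
    have eq: "cox_eq m w (v @ d)" and len: "length w = length v + length d" and d: "set d \<subseteq> {s, t}"
      using vd by (auto simp: Q_def)
    have shorter: "length v < length w" using min[OF \<open>Q (w0, [t])\<close>] snoc by simp
    have "reduced m (v @ d)" using reduced_cox_eq[OF red eq] len by simp
    then have redv: "reduced m v" by (rule reduced_appendD)
    have "cox_eq m (w @ [s]) ((v @ d) @ [s])" by (intro cox_eq_append eq cox_eq_refl)
    then have "reduced m ((v @ d) @ [s])"
      by (rule reduced_cox_eq[OF less.prems]) (simp add: len)
    then have redds: "reduced m (d @ [s])" using reduced_appendD(2)[of m v "d @ [s]"] by simp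
    have pos: "act m v (axis x 1) $ i \<ge> 0" if x: "x \<in> {s, t}" for x
    \<comment> \<open>If \<open>x\<close> shortened \<open>v\<close>, it could be moved from the end
      of \<open>v\<close> to the front of \<open>d\<close>, against minimality.\<close>
    proof (rule less.hyps[OF shorter], rule ccontr)
      assume "\<not> reduced m (v @ [x])"
      then obtain v' where v': "cox_eq m v (v' @ [x])" "length v = Suc (length v')"
        using not_reduced_snoc[OF m redv] by blast
      have "cox_eq m (v @ d) ((v' @ [x]) @ d)" by (intro cox_eq_append v' cox_eq_refl)
      then have "cox_eq m w (v' @ x # d)" using cox_eq_trans[OF eq] by simp
      then have "Q (v', x # d)" using d x len v'(2) by (simp add: Q_def)
      then show False using min v'(2) by fastforce
    qed
    have "d \<noteq> []" using len shorter by auto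
    moreover have "last d \<noteq> s"
    proof
      assume "last d = s"
      then have "d @ [s] = butlast d @ [s, s]"
        using \<open>d \<noteq> []\<close> append_butlast_last_id[of d] by simp
      then have "reduced m [s, s]" using redds reduced_appendD(2) by metis
      then show False using not_reduced_square[OF m] by blast
    qed
    ultimately have "last d = t" using d last_in_set[of d] by blast
    then have dalt: "d = altw (length d) s t"
      using reduced_dihedral_altw[OF m _ d] reduced_appendD(1)[OF redds] by blast
    define n where "n = length d"
    have "altw (Suc n) t s = d @ [s]" using dalt by (simp add: n_def)
    then have ralt: "reduced m (altw (Suc n) t s)" using redds by simp
    obtain U where U: "U 0 = 0" "U 1 = 1"
        "\<And>k. U (Suc (Suc k)) = - 2 * tits_coeff m t s * U (Suc k) - U k"
        "\<And>k. enat k \<le> m t s \<Longrightarrow> U k \<ge> 0"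
      using dihedral_coeffs[OF m \<open>t \<noteq> s\<close>] by metis
    \<comment> \<open>The alternating word \<open>d @ [s]\<close> is reduced, so its length stays in
      the range where \<open>U\<close> is non-negative.\<close>
    have Suc_n: "enat (Suc n) \<le> m t s"
    proof (cases "m t s")
      case (enat k)
      have "\<not> k < Suc n" using not_reduced_altw[OF m enat \<open>t \<noteq> s\<close>] ralt by blast
      then show ?thesis by (simp add: enat)
    qed simp
    then have "enat n \<le> m t s" by (rule order_trans[rotated]) simp
    then have Un: "U n \<ge> 0" "U (Suc n) \<ge> 0" using U(4) Suc_n by auto
    have "act m d (axis s 1) =
      (if even n then U (Suc n) *\<^sub>R axis s 1 + U n *\<^sub>R axis t 1
       else U n *\<^sub>R axis s 1 + U (Suc n) *\<^sub>R axis t 1)"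
      using act_altw_axis[OF m U(1,2,3), where x = s and y = t and k = n] dalt
      by (metis insert_commute n_def)
    then obtain p q where pq: "act m d (axis s 1) = p *\<^sub>R axis s 1 + q *\<^sub>R axis t 1" "p \<ge> 0" "q \<ge> 0"
      using Un by (metis (full_types))
    have "act m w (axis s 1) = act m v (act m d (axis s 1))"
      by (simp only: act_cox_eq[OF m eq] act_append)
    also have "\<dots> = p *\<^sub>R act m v (axis s 1) + q *\<^sub>R act m v (axis t 1)"
      by (simp add: pq linear_add[OF linear_act] linear_scale[OF linear_act])
    finally show ?thesis using pos pq by simp
  qed
qed

text \<open>The last letter \<open>s\<close> of a reduced word works: the word before it sends
  \<open>axis s 1\<close> to a non-negative root, and \<open>s\<close> itself reverses the
  sign.\<close>

lemma nontrivial_nonpos_root: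
  assumes m: "coxeter_matrix m" and w: "\<not> cox_eq m w []"
  obtains s where "\<And>i. act m w (axis s 1) $ i \<le> 0"
proof -
  obtain v where v: "cox_eq m w v" "reduced m v" using ex_reduced by blast
  obtain v' s where vs: "v = v' @ [s]" using w v(1) by (cases v rule: rev_cases) auto
  have "act m w (axis s 1) = - act m v' (axis s 1)"
    by (simp only: act_cox_eq[OF m v(1)] vs act_snoc_axis[OF m])
  moreover have "act m v' (axis s 1) $ i \<ge> 0" for i
    using reduced_snoc_nonneg[OF m] v(2) vs by blast
  ultimately show ?thesis using that[of s] by simp
qed

subsection \<open>Reflections of a symmetric bilinear form\<close>

locale symmetric_form =
  fixes B :: "'v::euclidean_space \<Rightarrow> 'v \<Rightarrow> real"
  assumes bilinear: "bilinear B" and sym: "B x y = B y x"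
begin

lemmas form_simps =
  bilinear_ladd[OF bilinear] bilinear_radd[OF bilinear]
  bilinear_lsub[OF bilinear] bilinear_rsub[OF bilinear]
  bilinear_lmul[OF bilinear] bilinear_rmul[OF bilinear]
  bilinear_lneg[OF bilinear] bilinear_rneg[OF bilinear]
  bilinear_lzero[OF bilinear] bilinear_rzero[OF bilinear]

definition refl :: "'v \<Rightarrow> 'v \<Rightarrow> 'v" where
  "refl c v = v - (2 * B c v / B c c) *\<^sub>R c"

text \<open>Division by zero makes the reflection along an isotropic vector the identity.\<close>

lemma refl_isotropic: "B c c = 0 \<Longrightarrow> refl c = id"
  by (simp add: refl_def fun_eq_iff)

lemma linear_refl: "linear (refl c)"
  by (rule linearI) (simp_all add: refl_def form_simps algebra_simps add_divide_distrib)

lemma refl_self: "B c c \<noteq> 0 \<Longrightarrow> refl c c = - c"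
  by (simp add: refl_def scaleR_2)

lemma refl_orthogonal: "B c v = 0 \<Longrightarrow> refl c v = v"
  by (simp add: refl_def)

lemma refl_refl [simp]: "refl c (refl c v) = v"
  by (cases "B c c = 0") (simp_all add: refl_def form_simps algebra_simps)

lemma form_refl [simp]: "B (refl c v) (refl c w) = B v w"
  by (cases "B c c = 0") (simp_all add: refl_def form_simps sym[of v c] field_simps)

lemma refl_scale: "k \<noteq> 0 \<Longrightarrow> refl (k *\<^sub>R c) = refl c"
  by (auto simp: refl_def form_simps fun_eq_iff field_simps)

lemma refl_conj: "refl (refl a c) = refl a \<circ> refl c \<circ> refl a"
proof
  fix v
  have "B (refl a c) v = B c (refl a v)"
    using form_refl[of a c "refl a v"] by simp
  then have "refl (refl a c) v = v - (2 * B c (refl a v) / B c c) *\<^sub>R refl a c"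
    by (simp add: refl_def[of "refl a c"])
  also have "\<dots> = refl a (refl c (refl a v))"
    unfolding refl_def[of c]
    by (simp add: linear_diff[OF linear_refl] linear_scale[OF linear_refl])
  finally show "refl (refl a c) v = (refl a \<circ> refl c \<circ> refl a) v" by simp
qed

lemma refl_ker: "v \<in> form_ker B \<Longrightarrow> refl c v = v"
  using sym[of v c] by (simp add: refl_def form_ker_def)

end

subsection \<open>Polynomial functions on endomorphisms\<close>

inductive endo_poly :: "(('v::real_vector \<Rightarrow> 'v) \<Rightarrow> real) \<Rightarrow> bool" where
  coeff: "linear \<psi> \<Longrightarrow> endo_poly (\<lambda>f. \<psi> (f v))"
| const: "endo_poly (\<lambda>f. c)"
| add: "endo_poly p \<Longrightarrow> endo_poly q \<Longrightarrow> endo_poly (\<lambda>f. p f + q f)"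
| mult: "endo_poly p \<Longrightarrow> endo_poly q \<Longrightarrow> endo_poly (\<lambda>f. p f * q f)"

lemma endo_poly_comp_left: "endo_poly p \<Longrightarrow> linear h \<Longrightarrow> endo_poly (\<lambda>f. p (h \<circ> f))"
proof (induction rule: endo_poly.induct)
  case (coeff \<psi> v)
  then show ?case using endo_poly.coeff[of "\<psi> \<circ> h" v] by (simp add: linear_compose)
qed (auto intro: endo_poly.intros)

lemma endo_poly_comp_right: "endo_poly p \<Longrightarrow> endo_poly (\<lambda>f. p (f \<circ> h))"
proof (induction rule: endo_poly.induct)
  case (coeff \<psi> v)
  then show ?case using endo_poly.coeff[of \<psi> "h v"] by simp
qed (auto intro: endo_poly.intros)

text \<open>The Zariski closure of \<open>H\<close> inside \<open>End V\<close>.\<close>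

definition endo_closure :: "('v::real_vector \<Rightarrow> 'v) set \<Rightarrow> ('v \<Rightarrow> 'v) set" where
  "endo_closure H = {f. linear f \<and> (\<forall>p. endo_poly p \<longrightarrow> (\<forall>h\<in>H. p h = 0) \<longrightarrow> p f = 0)}"

lemma endo_closure_superset: "\<forall>h\<in>H. linear h \<Longrightarrow> H \<subseteq> endo_closure H"
  by (auto simp: endo_closure_def)

text \<open>Composition is polynomial in each factor separately: first the left factor is kept in
  \<open>H\<close> and the right one moves to the closure, then the left one moves as well.\<close>

lemma endo_closure_comp:
  assumes lin: "\<forall>h\<in>H. linear h" and comp: "\<And>g h. g \<in> H \<Longrightarrow> h \<in> H \<Longrightarrow> g \<circ> h \<in> H"
    and f: "f \<in> endo_closure H" and g: "g \<in> endo_closure H"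
  shows "f \<circ> g \<in> endo_closure H"
proof -
  have "p (f \<circ> g) = 0" if p: "endo_poly p" "\<forall>h\<in>H. p h = 0" for p
  proof -
    have "p (h \<circ> g) = 0" if "h \<in> H" for h
      using g endo_poly_comp_left[OF p(1)] lin that p(2) comp
      unfolding endo_closure_def by blast
    then show ?thesis
      using f endo_poly_comp_right[OF p(1), of g] unfolding endo_closure_def by blast
  qed
  then show ?thesis
    using f g by (auto simp: endo_closure_def linear_compose)
qed

context symmetric_form
begin

text \<open>Each matrix coefficient of \<open>refl c\<close> is a quadratic polynomial in
  \<open>c\<close> divided by \<open>B c c\<close>. Along a line, a power of this denominator clears
  all fractions and leaves a polynomial in \<open>t\<close>.\<close>

lemma endo_poly_refl_line:
  assumes "endo_poly p"
  shows "\<exists>N q. \<forall>t. B (a + t *\<^sub>R b) (a + t *\<^sub>R b) \<noteq> 0 \<longrightarrow>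
    poly q t = B (a + t *\<^sub>R b) (a + t *\<^sub>R b) ^ N * p (refl (a + t *\<^sub>R b))"
  using assms
proof (induction rule: endo_poly.induct)
  case (coeff \<psi> v)
  define q where "q = smult (\<psi> v) [:B a a, 2 * B a b, B b b:]
    - smult 2 ([:B a v, B b v:] * [:\<psi> a, \<psi> b:])"
  have "poly q t = B (a + t *\<^sub>R b) (a + t *\<^sub>R b) ^ 1 * \<psi> (refl (a + t *\<^sub>R b) v)"
    if "B (a + t *\<^sub>R b) (a + t *\<^sub>R b) \<noteq> 0" for t
  proof -
    have "B (a + t *\<^sub>R b) (a + t *\<^sub>R b) * \<psi> (refl (a + t *\<^sub>R b) v) =
        B (a + t *\<^sub>R b) (a + t *\<^sub>R b) * \<psi> v - 2 * B (a + t *\<^sub>R b) v * \<psi> (a + t *\<^sub>R b)"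
      using that unfolding refl_def
      by (simp add: linear_diff[OF coeff] linear_scale[OF coeff] right_diff_distrib)
    then show ?thesis
      by (simp add: q_def linear_add[OF coeff] linear_scale[OF coeff] form_simps sym[of b a]
          algebra_simps)
  qed
  then show ?case by blast
next
  case (const c)
  have "\<forall>t. poly [:c:] t = B (a + t *\<^sub>R b) (a + t *\<^sub>R b) ^ 0 * c" by simp
  then show ?case by blast
next
  case (add p1 p2)
  obtain N1 q1 N2 q2 where q: "\<And>t. B (a + t *\<^sub>R b) (a + t *\<^sub>R b) \<noteq> 0 \<Longrightarrow>
      poly q1 t = B (a + t *\<^sub>R b) (a + t *\<^sub>R b) ^ N1 * p1 (refl (a + t *\<^sub>R b))"
    "\<And>t. B (a + t *\<^sub>R b) (a + t *\<^sub>R b) \<noteq> 0 \<Longrightarrow>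
      poly q2 t = B (a + t *\<^sub>R b) (a + t *\<^sub>R b) ^ N2 * p2 (refl (a + t *\<^sub>R b))"
    using add.IH by blast
  define Q where "Q = [:B a a, 2 * B a b, B b b:]"
  have Q: "poly Q t = B (a + t *\<^sub>R b) (a + t *\<^sub>R b)" for t
    by (simp add: Q_def form_simps sym[of b a] algebra_simps)
  have "poly (q1 * Q ^ N2 + q2 * Q ^ N1) t = B (a + t *\<^sub>R b) (a + t *\<^sub>R b) ^ (N1 + N2) *
      (p1 (refl (a + t *\<^sub>R b)) + p2 (refl (a + t *\<^sub>R b)))"
    if "B (a + t *\<^sub>R b) (a + t *\<^sub>R b) \<noteq> 0" for t
    using q[OF that] by (simp add: Q poly_power power_add algebra_simps)
  then show ?case by blast
next
  case (mult p1 p2)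
  obtain N1 q1 N2 q2 where q: "\<And>t. B (a + t *\<^sub>R b) (a + t *\<^sub>R b) \<noteq> 0 \<Longrightarrow>
      poly q1 t = B (a + t *\<^sub>R b) (a + t *\<^sub>R b) ^ N1 * p1 (refl (a + t *\<^sub>R b))"
    "\<And>t. B (a + t *\<^sub>R b) (a + t *\<^sub>R b) \<noteq> 0 \<Longrightarrow>
      poly q2 t = B (a + t *\<^sub>R b) (a + t *\<^sub>R b) ^ N2 * p2 (refl (a + t *\<^sub>R b))"
    using mult.IH by blast
  have "poly (q1 * q2) t = B (a + t *\<^sub>R b) (a + t *\<^sub>R b) ^ (N1 + N2) *
      (p1 (refl (a + t *\<^sub>R b)) * p2 (refl (a + t *\<^sub>R b)))"
    if "B (a + t *\<^sub>R b) (a + t *\<^sub>R b) \<noteq> 0" for t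
    using q[OF that] by (simp add: power_add algebra_simps)
  then show ?case by blast
qed

end

section \<open>Vectors whose reflection lies in the Zariski closure\<close>

locale reflection_monoid = symmetric_form B for B :: "'v::euclidean_space \<Rightarrow> 'v \<Rightarrow> real" +
  fixes H :: "('v \<Rightarrow> 'v) set"
  assumes H_linear: "\<forall>h\<in>H. linear h"
    and H_id: "id \<in> H"
    and H_comp: "g \<in> H \<Longrightarrow> h \<in> H \<Longrightarrow> g \<circ> h \<in> H"
begin

definition mirrors :: "'v set" where
  "mirrors = {c. refl c \<in> endo_closure H}"

lemma closure_id: "id \<in> endo_closure H"
  using endo_closure_superset[OF H_linear] H_id by blast

lemma closure_comp: "f \<in> endo_closure H \<Longrightarrow> g \<in> endo_closure H \<Longrightarrow> f \<circ> g \<in> endo_closure H"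
  by (rule endo_closure_comp[OF H_linear H_comp])

lemma isotropic_mirrors: "B c c = 0 \<Longrightarrow> c \<in> mirrors"
  using closure_id by (simp add: mirrors_def refl_isotropic)

lemma scale_mirrors: "c \<in> mirrors \<Longrightarrow> k *\<^sub>R c \<in> mirrors"
  by (cases "k = 0") (simp add: isotropic_mirrors form_simps, simp add: mirrors_def refl_scale)

lemma refl_mirrors: "a \<in> mirrors \<Longrightarrow> c \<in> mirrors \<Longrightarrow> refl a c \<in> mirrors"
  by (simp add: mirrors_def refl_conj closure_comp)

text \<open>After clearing denominators, a polynomial function vanishing on \<open>H\<close> becomes
  a polynomial in \<open>t\<close> with infinitely many roots, hence zero. Isotropic points of the
  line are mirrors by the convention on \<open>refl\<close>.\<close>

lemma line_mirrors:
  assumes inf: "infinite T" and T: "\<And>t. t \<in> T \<Longrightarrow> B (a + t *\<^sub>R b) (a + t *\<^sub>R b) \<noteq> 0"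
      "\<And>t. t \<in> T \<Longrightarrow> a + t *\<^sub>R b \<in> mirrors"
  shows "a + r *\<^sub>R b \<in> mirrors"
proof (cases "B (a + r *\<^sub>R b) (a + r *\<^sub>R b) = 0")
  case True
  then show ?thesis by (rule isotropic_mirrors)
next
  case False
  have "p (refl (a + r *\<^sub>R b)) = 0" if p: "endo_poly p" "\<forall>h\<in>H. p h = 0" for p
  proof -
    obtain N q where q: "\<And>t. B (a + t *\<^sub>R b) (a + t *\<^sub>R b) \<noteq> 0 \<Longrightarrow>
        poly q t = B (a + t *\<^sub>R b) (a + t *\<^sub>R b) ^ N * p (refl (a + t *\<^sub>R b))"
      using endo_poly_refl_line[OF p(1)] by blast
    have "poly q t = 0" if "t \<in> T" for t
    proof -
      have "p (refl (a + t *\<^sub>R b)) = 0"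
        using T(2)[OF that] p by (auto simp: mirrors_def endo_closure_def)
      then show ?thesis using q[OF T(1)[OF that]] by simp
    qed
    then have "T \<subseteq> {t. poly q t = 0}" by blast
    then have "q = 0" using inf poly_roots_finite finite_subset by blast
    then show ?thesis using q[OF False] False by simp
  qed
  then show ?thesis by (simp add: mirrors_def endo_closure_def linear_refl)
qed

text \<open>With \<open>\<kappa> c = B(a,c)\<^sup>2 / (B(a,a) B(c,c))\<close> one has \<open>\<kappa> (refl c a) = (1 - 2 \<kappa> c)\<^sup>2\<close>, so that
  iterating \<open>c \<mapsto> refl c a\<close> from \<open>b\<close> strictly increases \<open>\<kappa>\<close> as soon as \<open>\<kappa> b\<close> lies outside \<open>[0, 1]\<close>.\<close>

lemma hyperbolic_plane_mirrors:
  assumes a: "a \<in> mirrors" "B a a \<noteq> 0" and b: "b \<in> mirrors" "B b b \<noteq> 0"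
    and \<kappa>: "(B a b)\<^sup>2 / (B a a * B b b) \<notin> {0..1}"
  shows "a + r *\<^sub>R b \<in> mirrors"
proof -
  define \<kappa> where "\<kappa> c = (B a c)\<^sup>2 / (B a a * B c c)" for c
  define c where "c n = ((\<lambda>c. refl c a) ^^ n) b" for n
  have c0: "c 0 = b" and cSuc: "c (Suc n) = refl (c n) a" for n
    by (simp_all add: c_def)
  have c_mirror: "c n \<in> mirrors \<and> B (c n) (c n) \<noteq> 0" for n
    by (induction n) (use a b in \<open>auto simp: c0 cSuc refl_mirrors\<close>)
  have \<kappa>Suc: "\<kappa> (c (Suc n)) = (1 - 2 * \<kappa> (c n))\<^sup>2" for n
  proof -
    have n: "B (c n) (c n) \<noteq> 0" using c_mirror by blast
    have "B a (c (Suc n)) = B a a * (1 - 2 * \<kappa> (c n))"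
      using a n unfolding cSuc \<kappa>_def refl_def
      by (simp add: form_simps sym[of "c n" a] field_simps power2_eq_square)
    moreover have "B (c (Suc n)) (c (Suc n)) = B a a" by (simp add: cSuc)
    ultimately show ?thesis using a by (simp add: \<kappa>_def power_mult_distrib power2_eq_square)
  qed
  have gt: "x < (1 - 2 * x)\<^sup>2 \<and> (1 - 2 * x)\<^sup>2 > 1" if "x \<notin> {0..1}" for x :: real
  proof -
    have "x * (x - 1) > 0" using that by (auto simp: zero_less_mult_iff)
    moreover have "(1 - 2 * x)\<^sup>2 - 1 = 4 * (x * (x - 1))"
      by (simp add: power2_eq_square algebra_simps)
    ultimately have 1: "(1 - 2 * x)\<^sup>2 > 1" by linarith
    show ?thesis
    proof (cases "x > 1")
      case True
      then have "(4 * x - 1) * (x - 1) > 0" by simp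
      then have "(1 - 2 * x)\<^sup>2 > x" by (simp add: power2_eq_square algebra_simps)
      then show ?thesis using 1 by simp
    next
      case False
      then show ?thesis using 1 by linarith
    qed
  qed
  have out: "\<kappa> (c n) \<notin> {0..1}" for n
  proof (induction n)
    case 0
    then show ?case using \<kappa> by (simp add: c0 \<kappa>_def)
  next
    case (Suc n)
    then show ?case using gt[OF Suc] by (simp add: \<kappa>Suc)
  qed
  have "\<kappa> (c n) < \<kappa> (c (Suc n))" for n using gt[OF out] by (simp add: \<kappa>Suc)
  then have mono: "strict_mono (\<lambda>n. \<kappa> (c n))" by (simp add: strict_mono_Suc_iff)
  have \<kappa>_scale: "\<kappa> (k *\<^sub>R v) = \<kappa> v" if "k \<noteq> 0" for k v
    using that by (simp add: \<kappa>_def form_simps power2_eq_square)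
  have "\<exists>x y. c n = x *\<^sub>R a + y *\<^sub>R b" for n
  proof (induction n)
    case 0
    have "c 0 = 0 *\<^sub>R a + 1 *\<^sub>R b" by (simp add: c0)
    then show ?case by blast
  next
    case (Suc n)
    then obtain x y where xy: "c n = x *\<^sub>R a + y *\<^sub>R b" by blast
    define k where "k = 2 * B (c n) a / B (c n) (c n)"
    have "c (Suc n) = a - k *\<^sub>R c n" by (simp add: cSuc refl_def k_def)
    also have "\<dots> = (1 - k * x) *\<^sub>R a + (- k * y) *\<^sub>R b" by (simp add: xy algebra_simps)
    finally show ?case by blast
  qed
  then obtain x y where xy: "\<And>n. c n = x n *\<^sub>R a + y n *\<^sub>R b" by metis
  \<comment> \<open>Otherwise \<open>c (Suc n)\<close> would be a multiple of \<open>b\<close> and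
    have the same \<open>\<kappa>\<close> as \<open>c 0\<close>.\<close>
  have x: "x (Suc n) \<noteq> 0" for n
  proof
    assume "x (Suc n) = 0"
    then have *: "c (Suc n) = y (Suc n) *\<^sub>R b" by (simp add: xy)
    then have "y (Suc n) \<noteq> 0" using c_mirror[of "Suc n"] by (auto simp: form_simps)
    then have "\<kappa> (c (Suc n)) = \<kappa> (c 0)" by (simp add: * \<kappa>_scale c0)
    then show False using strict_mono_eq[OF mono, of "Suc n" 0] by simp
  qed
  \<comment> \<open>\<open>t n\<close> is the parameter at which the line through \<open>a\<close>
    in direction \<open>b\<close> meets the span of \<open>c (Suc n)\<close>. Since
    \<open>\<kappa>\<close> is scale invariant and strictly increasing, these parameters are
    distinct.\<close>
  define t where "t n = y (Suc n) / x (Suc n)" for n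
  have t: "c (Suc n) = x (Suc n) *\<^sub>R (a + t n *\<^sub>R b)" for n
    using x[of n] by (simp add: xy t_def algebra_simps)
  have "\<kappa> (c (Suc n)) = \<kappa> (a + t n *\<^sub>R b)" for n
    unfolding t by (rule \<kappa>_scale[OF x])
  then have "inj t" using strict_mono_eq[OF mono] by (metis injI nat.inject)
  then have "infinite (range t)" by (rule range_inj_infinite)
  then show ?thesis
  proof (rule line_mirrors)
    fix s assume "s \<in> range t"
    then obtain n where n: "s = t n" by blast
    have *: "a + s *\<^sub>R b = (1 / x (Suc n)) *\<^sub>R c (Suc n)"
      unfolding n t using x[of n] by simp
    show "a + s *\<^sub>R b \<in> mirrors" unfolding * using c_mirror scale_mirrors by blast
    show "B (a + s *\<^sub>R b) (a + s *\<^sub>R b) \<noteq> 0"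
      unfolding * using c_mirror[of "Suc n"] x[of n] by (simp add: form_simps)
  qed
qed

text \<open>Close to the negative vector \<open>a\<close>, every vector of the larger space lies in a hyperbolic plane
  spanned by \<open>e\<close> and a vector of \<open>U\<close>; the line principle propagates this to the whole space.\<close>

lemma insert_mirrors:
  assumes U: "subspace U" "U \<subseteq> mirrors"
    and a0: "a0 \<in> U" "B a0 a0 < 0" and b: "b \<in> U" "B b e \<noteq> 0"
    and e: "e \<in> mirrors" "B e e > 0"
  shows "span (insert e U) \<subseteq> mirrors"
proof -
  have small: "\<exists>d>0. \<forall>t. 0 < t \<longrightarrow> t < d \<longrightarrow> x + t * y + t\<^sup>2 * z < 0"
    if "x < 0" for x y z :: real
  proof -
    have "((\<lambda>t. x + t * y + t\<^sup>2 * z) \<longlongrightarrow> x + 0 * y + 0\<^sup>2 * z) (at_right 0)"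
      by (intro tendsto_intros)
    then have "eventually (\<lambda>t. x + t * y + t\<^sup>2 * z < 0) (at_right 0)"
      using that by (intro order_tendstoD(2)) auto
    then show ?thesis unfolding eventually_at_right_field by auto
  qed
  have plane: "a + t *\<^sub>R e \<in> mirrors" if "a \<in> U" "B a a < 0" "B a e \<noteq> 0" for a t
  proof (rule hyperbolic_plane_mirrors)
    have "(B a e)\<^sup>2 / (B a a * B e e) < 0"
      using that e by (intro divide_pos_neg) (auto simp: mult_neg_pos)
    then show "(B a e)\<^sup>2 / (B a a * B e e) \<notin> {0..1}" by simp
  qed (use that U e in auto)
  obtain a where a: "a \<in> U" "B a a < 0" "B a e \<noteq> 0"
  proof (cases "B a0 e = 0")
    case False
    then show ?thesis using that a0 by blast
  next
    case True
    \<comment> \<open>If \<open>a0\<close> is orthogonal to \<open>e\<close>, a small move along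
      \<open>b\<close> destroys orthogonality and keeps the vector negative.\<close>
    from small[OF a0(2)] obtain d where d: "d > 0" "\<forall>t. 0 < t \<longrightarrow> t < d \<longrightarrow> B a0 a0 + t * (2 * B a0 b) + t\<^sup>2 * B b b < 0"
      by blast
    show ?thesis
    proof (rule that[of "a0 + (d / 2) *\<^sub>R b"])
      show "a0 + (d / 2) *\<^sub>R b \<in> U"
        using a0 b U(1) by (auto intro: subspace_add subspace_scale)
      show "B (a0 + (d / 2) *\<^sub>R b) (a0 + (d / 2) *\<^sub>R b) < 0"
        using d(2)[rule_format, of "d / 2"] d(1)
        by (simp add: form_simps sym[of b a0] power2_eq_square field_simps)
      show "B (a0 + (d / 2) *\<^sub>R b) e \<noteq> 0"
        using True b d by (simp add: form_simps)
    qed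
  qed
  show ?thesis
  proof
    fix c assume "c \<in> span (insert e U)"
    then obtain k where "c - k *\<^sub>R e \<in> span U" by (auto simp: span_breakdown_eq)
    moreover have "span U = U" using U(1) by (simp only: span_eq_iff)
    ultimately have cU: "c - k *\<^sub>R e \<in> U" by simp
    define a' where "a' = c - k *\<^sub>R e"
    define b' where "b' = a' - a"
    have b'U: "b' \<in> U" using cU a U(1) by (simp add: a'_def b'_def subspace_diff)
    from small[OF a(2)] obtain d1 where d1: "d1 > 0" "\<forall>t. 0 < t \<longrightarrow> t < d1 \<longrightarrow> B a a + t * (2 * B a b') + t\<^sup>2 * B b' b' < 0"
      by blast
    from small[OF a(2)] obtain d2 where d2: "d2 > 0" "\<forall>t. 0 < t \<longrightarrow> t < d2 \<longrightarrow>
        B a a + t * (2 * B a (c - a)) + t\<^sup>2 * B (c - a) (c - a) < 0"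
      by blast
    have "- (B a e)\<^sup>2 < 0" using a(3) by simp
    from small[OF this] obtain d3 where d3: "d3 > 0" "\<forall>t. 0 < t \<longrightarrow> t < d3 \<longrightarrow>
        - (B a e)\<^sup>2 + t * (- B a e * B b' e) + t\<^sup>2 * 0 < 0"
      by blast
    \<comment> \<open>For \<open>t\<close> below \<open>d\<close>, the \<open>U\<close>-part
      \<open>a + t b'\<close> stays negative, the point \<open>a + t (c - a)\<close> is not
      isotropic, and the pairing of the \<open>U\<close>-part with \<open>e\<close> keeps the sign
      of \<open>B a e\<close>. So \<open>plane\<close> applies, and \<open>line_mirrors\<close> then
      reaches \<open>c\<close> at parameter 1.\<close>
    define d where "d = Min {d1, d2, d3}"
    have d: "d > 0" "d \<le> d1" "d \<le> d2" "d \<le> d3" using d1 d2 d3 by (auto simp: d_def)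
    have "a + 1 *\<^sub>R (c - a) \<in> mirrors"
    proof (rule line_mirrors)
      show "infinite {0<..<d}" using d by simp
      fix t assume "t \<in> {0<..<d}"
      then have t: "0 < t" "t < d1" "t < d2" "t < d3" using d by auto
      show "B (a + t *\<^sub>R (c - a)) (a + t *\<^sub>R (c - a)) \<noteq> 0"
        using d2(2)[rule_format, OF t(1,3)]
        by (simp add: form_simps sym[of c a] power2_eq_square algebra_simps)
      have "(a + t *\<^sub>R b') + (t * k) *\<^sub>R e \<in> mirrors"
      proof (rule plane)
        show "a + t *\<^sub>R b' \<in> U" using a b'U U(1) by (auto intro: subspace_add subspace_scale)
        show "B (a + t *\<^sub>R b') (a + t *\<^sub>R b') < 0"
          using d1(2)[rule_format, OF t(1,2)]
          by (simp add: form_simps sym[of b' a] power2_eq_square algebra_simps)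
        have "B a e * B (a + t *\<^sub>R b') e > 0"
          using d3(2)[rule_format, OF t(1,4)]
          by (simp add: form_simps power2_eq_square algebra_simps)
        then show "B (a + t *\<^sub>R b') e \<noteq> 0" by auto
      qed
      moreover have "(a + t *\<^sub>R b') + (t * k) *\<^sub>R e = a + t *\<^sub>R (c - a)"
        by (simp add: b'_def a'_def algebra_simps)
      ultimately show "a + t *\<^sub>R (c - a) \<in> mirrors" by simp
    qed
    then show "c \<in> mirrors" by simp
  qed
qed

text \<open>Connectedness of \<open>E\<close> under non-orthogonality is stated as the absence of a non-trivial
  orthogonal splitting.\<close>

lemma all_mirrors:
  assumes E: "E \<subseteq> mirrors" "\<And>e. e \<in> E \<Longrightarrow> B e e > 0" "span E = UNIV"
    and irred: "\<And>E'. E' \<subseteq> E \<Longrightarrow> (\<forall>x\<in>E'. \<forall>y\<in>E - E'. B x y = 0) \<Longrightarrow> E' = {} \<or> E' = E"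
    and ab: "a \<in> mirrors" "b \<in> mirrors" "B a a = 1" "B b b = 1" "\<bar>B a b\<bar> > 1"
  shows "mirrors = UNIV"
proof -
  define good where
    "good U \<longleftrightarrow> subspace U \<and> U \<subseteq> mirrors \<and> (\<exists>v\<in>U. B v v < 0)" for U
  have good_ab: "good (span {a, b})"
    unfolding good_def
  proof (intro conjI)
    show "span {a, b} \<subseteq> mirrors"
    proof
      fix c assume "c \<in> span {a, b}"
      then obtain x y where c: "c = x *\<^sub>R a + y *\<^sub>R b" by (auto simp: span_insert algebra_simps)
      show "c \<in> mirrors"
      proof (cases "x = 0")
        case True
        then show ?thesis using c ab scale_mirrors by simp
      next
        case False
        have "(B a b)\<^sup>2 > 1" using ab(5) by (metis one_less_power power2_abs zero_less_numeral)
        then have "a + (y / x) *\<^sub>R b \<in> mirrors"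
          using ab by (intro hyperbolic_plane_mirrors) auto
        moreover have "c = x *\<^sub>R (a + (y / x) *\<^sub>R b)" using False by (simp add: c algebra_simps)
        ultimately show ?thesis using scale_mirrors by metis
      qed
    qed
    \<comment> \<open>The sign makes the cross term negative, so \<open>B v v\<close> is 2 minus
      twice the absolute value of \<open>B a b\<close>.\<close>
    define v where "v = a - sgn (B a b) *\<^sub>R b"
    have "sgn (B a b) * B a b = \<bar>B a b\<bar>" "sgn (B a b) * sgn (B a b) = 1"
      using ab(5) by (auto simp: sgn_if)
    then have "B v v = 2 - 2 * \<bar>B a b\<bar>"
      using ab by (simp add: v_def form_simps sym[of b a] algebra_simps)
    then have "B v v < 0" using ab(5) by simp
    moreover have "v \<in> span {a, b}"
      unfolding v_def by (intro span_diff span_scale span_base) auto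
    ultimately show "\<exists>v\<in>span {a, b}. B v v < 0" by blast
  qed simp
  have "\<forall>U. good U \<longrightarrow> dim U < Suc DIM('v)"
    by (simp add: dim_subset_UNIV less_Suc_eq_le)
  from ex_has_greatest_nat[OF good_ab this]
  obtain U where U: "good U" and max: "\<forall>U'. good U' \<longrightarrow> dim U' \<le> dim U" by blast
  obtain a0 where a0: "a0 \<in> U" "B a0 a0 < 0" and sub: "subspace U" and UM: "U \<subseteq> mirrors"
    using U by (auto simp: good_def)
  \<comment> \<open>Otherwise \<open>insert_mirrors\<close> would enlarge \<open>U\<close> by
    \<open>e\<close>, against maximality of the dimension.\<close>
  have dich: "e \<in> U \<or> (\<forall>u\<in>U. B u e = 0)" if e: "e \<in> E" for e
  proof (rule ccontr)
    assume "\<not> ?thesis"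
    then obtain b' where b': "e \<notin> U" "b' \<in> U" "B b' e \<noteq> 0" by blast
    have "span (insert e U) \<subseteq> mirrors"
      by (rule insert_mirrors[OF sub UM a0 b'(2,3)]) (use E e in auto)
    then have "good (span (insert e U))"
      using a0 unfolding good_def by (meson insertI2 span_base subspace_span)
    then have "dim (span (insert e U)) \<le> dim U" using max by blast
    moreover have "span U = U" using sub by (simp only: span_eq_iff)
    ultimately show False using b'(1) by (simp add: dim_span dim_insert)
  qed
  \<comment> \<open>By the dichotomy this is an orthogonal splitting of \<open>E\<close>. The empty
    case would make \<open>a0\<close> orthogonal to the whole space, hence isotropic.\<close>
  have "E \<inter> U = {} \<or> E \<inter> U = E"
  proof (rule irred)
    show "\<forall>x\<in>E \<inter> U. \<forall>y\<in>E - E \<inter> U. B x y = 0" using dich by blast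
  qed blast
  then have "E \<subseteq> U"
  proof
    assume "E \<inter> U = {}"
    then have "E \<subseteq> {v. B a0 v = 0}" using dich a0 by blast
    moreover have "subspace {v. B a0 v = 0}" by (auto simp: subspace_def form_simps)
    ultimately have "span E \<subseteq> {v. B a0 v = 0}" by (rule span_minimal)
    then have "B a0 a0 = 0" unfolding E(3) by blast
    then show ?thesis using a0 by simp
  qed blast
  then have "U = UNIV" using E(3) sub by (metis span_minimal top.extremum_uniqueI)
  then show ?thesis using UM by blast
qed

end

subsection \<open>The negative eigenvector of the Tits form\<close>

lemma tits_coeff_nonpos:
  assumes "coxeter_matrix m" "s \<noteq> t"
  shows "tits_coeff m s t \<le> 0"
proof (cases "m s t")
  case (enat k)
  have "enat k \<ge> 2" using assms enat unfolding coxeter_matrix_def by metis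
  then have "k \<ge> 2" by (simp add: numeral_eq_enat)
  then have "pi / real k \<le> pi / 2" by (intro divide_left_mono) auto
  moreover have "- (pi / 2) \<le> pi / real k" by (rule order_trans[of _ 0]) auto
  ultimately have "cos (pi / real k) \<ge> 0" by (intro cos_ge_zero)
  then show ?thesis by (simp add: tits_coeff_def enat)
qed (simp add: tits_coeff_def)

lemma tits_coeff_edge:
  assumes "(s, t) \<in> coxeter_graph m"
  shows "tits_coeff m s t < 0"
proof (cases "m s t")
  case (enat k)
  have "enat k \<ge> 3" using assms enat by (simp add: coxeter_graph_def)
  then have "k \<ge> 3" by (simp add: numeral_eq_enat)
  then have "pi / real k < pi / 2" by (intro divide_strict_left_mono) auto
  moreover have "- (pi / 2) < pi / real k" by (rule less_le_trans[of _ 0]) auto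
  ultimately have "cos (pi / real k) > 0" by (intro cos_gt_zero_pi)
  then show ?thesis by (simp add: tits_coeff_def enat)
qed (simp add: tits_coeff_def)

lemma vec_axis_expansion: "x = (\<Sum>s\<in>UNIV. x $ s *\<^sub>R axis s (1::real))"
  by (simp add: vec_eq_iff axis_def if_distrib cong: if_cong)

lemma tits_form_axis_right: "tits_form m x (axis s 1) = (\<Sum>t\<in>UNIV. x $ t * tits_coeff m t s)"
proof -
  have "tits_form m x (axis s 1) = (\<Sum>t\<in>UNIV. \<Sum>r\<in>UNIV. if r = s then x $ t * tits_coeff m t s else 0)"
    unfolding tits_form_def by (intro sum.cong) (auto simp: axis_def)
  then show ?thesis by simp
qed

text \<open>Off-diagonal coefficients are non-positive, so absolute values can only lower the mixed
  terms; the squares are unchanged.\<close>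

lemma tits_form_abs_le:
  assumes m: "coxeter_matrix m"
  shows "tits_form m (\<chi> s. \<bar>x $ s\<bar>) (\<chi> s. \<bar>x $ s\<bar>) \<le> tits_form m x x"
  unfolding tits_form_def
proof (intro sum_mono)
  fix s t
  show "(\<chi> s. \<bar>x $ s\<bar>) $ s * (\<chi> s. \<bar>x $ s\<bar>) $ t * tits_coeff m s t \<le> x $ s * x $ t * tits_coeff m s t"
  proof (cases "s = t")
    case False
    have "x $ s * x $ t \<le> \<bar>x $ s\<bar> * \<bar>x $ t\<bar>" by (metis abs_ge_self abs_mult)
    then show ?thesis
      using mult_right_mono_neg tits_coeff_nonpos[OF m False] by auto
  qed simp
qed

text \<open>The form \<open>B - \<mu> \<langle>\<cdot>,\<cdot>\<rangle>\<close> is positive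
  semidefinite and \<open>v\<close> is isotropic for it, so \<open>v\<close> lies in its
  kernel.\<close>

lemma tits_form_eigenvector:
  assumes m: "coxeter_matrix m" and lower: "\<And>v. \<mu> * (v \<bullet> v) \<le> tits_form m v v"
    and v: "tits_form m v v \<le> \<mu> * (v \<bullet> v)"
  shows "tits_form m v w = \<mu> * (v \<bullet> w)"
proof -
  define b where "b = tits_form m v w - \<mu> * (v \<bullet> w)"
  define c where "c = tits_form m w w - \<mu> * (w \<bullet> w)"
  have c: "c \<ge> 0" using lower[of w] by (simp add: c_def)
  have eq: "tits_form m v v = \<mu> * (v \<bullet> v)" using lower[of v] v by simp
  have q: "0 \<le> 2 * t * b + t\<^sup>2 * c" for t
  proof -
    have "0 \<le> tits_form m (v + t *\<^sub>R w) (v + t *\<^sub>R w) - \<mu> * ((v + t *\<^sub>R w) \<bullet> (v + t *\<^sub>R w))"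
      using lower[of "v + t *\<^sub>R w"] by simp
    also have "\<dots> = 2 * t * b + t\<^sup>2 * c"
      using eq by (simp add: tits_form_simps tits_form_sym[OF m, of w v] inner_commute[of w v]
          inner_simps b_def c_def power2_eq_square algebra_simps)
    finally show ?thesis .
  qed
  \<comment> \<open>The quadratic in \<open>t\<close> is tested near its minimum
    \<open>- b / c\<close>; \<open>c + 1\<close> keeps the denominator positive when
    \<open>c = 0\<close>.\<close>
  have "2 * (- b / (c + 1)) * b + (- b / (c + 1))\<^sup>2 * c = - (b\<^sup>2 * (c + 2)) / (c + 1)\<^sup>2"
    using c by (simp add: divide_simps power2_eq_square) (simp add: algebra_simps)
  then have "b\<^sup>2 * (c + 2) / (c + 1)\<^sup>2 \<le> 0" using q[of "- b / (c + 1)"] by simp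
  then have "b\<^sup>2 * (c + 2) \<le> 0" using c by (simp add: divide_le_0_iff)
  then have "b = 0" using c by (simp add: mult_le_0_iff)
  then show ?thesis by (simp add: b_def)
qed

text \<open>If the coordinate at \<open>s\<close> is zero, the eigenvalue equation paired with
  \<open>axis s 1\<close> is a vanishing sum of non-positive terms, so the coordinates at all
  neighbours of \<open>s\<close> vanish. Connectedness spreads this to the whole graph.\<close>

lemma eigenvector_positive:
  assumes m: "coxeter_matrix m" and irr: "coxeter_irreducible m"
    and v: "\<And>s. v $ s \<ge> 0" "v \<noteq> 0" and eig: "\<And>w. tits_form m v w = \<mu> * (v \<bullet> w)"
  shows "v $ s > 0"
proof (rule ccontr)
  assume "\<not> ?thesis"
  then have s: "v $ s = 0" using v(1)[of s] by simp
  have step: "v $ t = 0" if s: "v $ s = 0" and edge: "(s, t) \<in> coxeter_graph m" for s t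
  proof -
    have "(\<Sum>t\<in>UNIV. v $ t * tits_coeff m t s) = 0"
      using eig[of "axis s 1"] s by (simp add: tits_form_axis_right inner_axis)
    moreover have "v $ t * tits_coeff m t s \<le> 0" for t
      using v(1)[of t] s tits_coeff_nonpos[OF m, of t s]
      by (cases "t = s") (auto simp: mult_nonneg_nonpos)
    ultimately have "v $ t * tits_coeff m t s = 0"
      using sum_nonneg_eq_0_iff[of UNIV "\<lambda>t. - (v $ t * tits_coeff m t s)"] by (simp add: sum_negf)
    moreover have "m s t = m t s" using m by (simp add: coxeter_matrix_def)
    then have "tits_coeff m t s < 0"
      using tits_coeff_edge[OF edge] by (simp add: tits_coeff_def)
    ultimately show ?thesis by simp
  qed
  have "v $ t = 0" for t
  proof -
    have "(s, t) \<in> (coxeter_graph m)\<^sup>*" using irr by (simp add: coxeter_irreducible_def)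
    then show ?thesis by (induction rule: rtrancl_induct) (use s step in auto)
  qed
  then show False using v(2) by (simp add: vec_eq_iff)
qed

text \<open>Perron--Frobenius: the lowest eigenvalue of the Tits form is attained at a positive vector. If it
  is zero, every kernel vector is a minimizer, so its absolute value vanishes nowhere, and the kernel
  is a line.\<close>

lemma negative_eigenvector:
  fixes m :: "'s::finite \<Rightarrow> 's \<Rightarrow> enat"
  assumes m: "coxeter_matrix m" and na: "non_affine m"
  obtains u \<mu> where "\<mu> < 0" "\<And>s. u $ s > 0" "\<And>w. tits_form m u w = \<mu> * (u \<bullet> w)"
proof -
  have irr: "coxeter_irreducible m" using na by (simp add: non_affine_def)
  have ne: "sphere (0 :: real ^ 's) 1 \<noteq> {}"
    using norm_axis_1[of undefined] by (metis dist_0_norm empty_iff mem_sphere)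
  have "continuous_on (sphere 0 1) (\<lambda>v. tits_form m v v)"
    unfolding tits_form_def by (intro continuous_intros)
  from continuous_attains_inf[OF compact_sphere ne this]
  obtain v0 where v0: "norm v0 = 1" and min: "\<And>v. norm v = 1 \<Longrightarrow> tits_form m v0 v0 \<le> tits_form m v v"
    by auto
  define \<mu> where "\<mu> = tits_form m v0 v0"
  have lower: "\<mu> * (v \<bullet> v) \<le> tits_form m v v" for v
  proof (cases "v = 0")
    case False
    define w where "w = (1 / norm v) *\<^sub>R v"
    have "norm w = 1" using False by (simp add: w_def)
    then have "\<mu> \<le> tits_form m w w" using min by (simp add: \<mu>_def)
    also have "\<dots> = tits_form m v v / (v \<bullet> v)"
      by (simp add: w_def tits_form_simps dot_square_norm power2_eq_square)
    finally show ?thesis using False by (simp add: field_simps)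
  qed (simp add: tits_form_def)
  have abs_inner: "(\<chi> s. \<bar>v $ s\<bar>) \<bullet> (\<chi> s. \<bar>v $ s\<bar>) = v \<bullet> v" for v :: "real ^ 's"
    by (simp add: inner_vec_def)
  have abs_eig: "tits_form m (\<chi> s. \<bar>v $ s\<bar>) w = \<mu> * ((\<chi> s. \<bar>v $ s\<bar>) \<bullet> w)"
    if "tits_form m v v \<le> \<mu> * (v \<bullet> v)" for v w
    by (rule tits_form_eigenvector[OF m lower])
      (use tits_form_abs_le[OF m, of v] that abs_inner[of v] in simp)
  \<comment> \<open>If \<open>v\<close> attains the minimum, so does its absolute value, which is
    then a positive eigenvector: a minimizer has no zero coordinate.\<close>
  have abs_pos: "\<bar>v $ s\<bar> > 0" if "tits_form m v v \<le> \<mu> * (v \<bullet> v)" "v \<noteq> 0" for v s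
    using eigenvector_positive[OF m irr, of "\<chi> s. \<bar>v $ s\<bar>" \<mu> s] abs_eig[OF that(1)] that(2)
    by (simp add: vec_eq_iff)
  define u where "u = (\<chi> s. \<bar>v0 $ s\<bar>)"
  have v0_min: "tits_form m v0 v0 \<le> \<mu> * (v0 \<bullet> v0)" using v0 by (simp add: \<mu>_def dot_square_norm)
  have u_eig: "tits_form m u w = \<mu> * (u \<bullet> w)" for w
    unfolding u_def by (rule abs_eig[OF v0_min])
  have u_pos: "u $ s > 0" for s
    using abs_pos[OF v0_min] v0 by (force simp: u_def)
  have "\<mu> < 0"
  proof (rule ccontr)
    assume "\<not> \<mu> < 0"
    then consider "\<mu> > 0" | "\<mu> = 0" by linarith
    then show False
    proof cases
      case 1
      have "tits_form m v v > 0" if "v \<noteq> 0" for v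
        using lower[of v] 1 that by (metis inner_gt_zero_iff less_le_trans mult_pos_pos)
      then have "spherical_type m" using irr by (simp add: spherical_type_def)
      then show False using na by (simp add: non_affine_def)
    next
      case 2
      have "form_ker (tits_form m) = span {u}"
      proof
        have "u \<in> form_ker (tits_form m)" using u_eig 2 by (simp add: form_ker_def)
        then show "span {u} \<subseteq> form_ker (tits_form m)"
          using subspace_form_ker[OF bilinear_tits_form] by (intro span_minimal) auto
        show "form_ker (tits_form m) \<subseteq> span {u}"
        proof
          fix k assume k: "k \<in> form_ker (tits_form m)"
          define s :: 's where "s = undefined"
          \<comment> \<open>The multiple of \<open>u\<close> is chosen to cancel the coordinate at
            \<open>s\<close>; a kernel vector with a zero coordinate must be zero.\<close>
          define k' where "k' = k - (k $ s / u $ s) *\<^sub>R u"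
          have "tits_form m k' k' = 0"
            using k u_eig 2 unfolding k'_def form_ker_def by (simp add: tits_form_simps)
          moreover have "k' $ s = 0" using u_pos[of s] by (simp add: k'_def)
          ultimately have "k' = 0" using abs_pos[of k' s] 2 by fastforce
          then have "k = (k $ s / u $ s) *\<^sub>R u" by (simp add: k'_def)
          then show "k \<in> span {u}" by (metis singletonI span_base span_scale)
        qed
      qed
      moreover have "u \<noteq> 0" using u_pos by (metis less_irrefl zero_index)
      ultimately have "dim (form_ker (tits_form m)) = 1" by simp
      then have "affine_type m" using irr lower 2 by (simp add: affine_type_def)
      then show False using na by (simp add: non_affine_def)
    qed
  qed
  then show ?thesis using that u_pos u_eig by blast
qed

section \<open>Roots paired with the negative eigenvector\<close>

locale negative_coxeter =
  fixes m :: "'s::finite \<Rightarrow> 's \<Rightarrow> enat" and u :: "real ^ 's" and \<mu> :: real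
  assumes m: "coxeter_matrix m" and neg: "\<mu> < 0" and u_pos: "u $ s > 0"
    and u_eig: "tits_form m u w = \<mu> * (u \<bullet> w)"
begin

text \<open>The reflection \<open>r_s\<close> adds to \<open>u\<close> the non-negative multiple
  \<open>- 2 * \<mu> * u $ s\<close> of \<open>axis s 1\<close>, and along a reduced word the
  preceding letters map this vector to a non-negative one.\<close>

lemma act_ge: "u $ i \<le> act m w u $ i"
proof -
  obtain v where v: "cox_eq m w v" "reduced m v" using ex_reduced by blast
  have "u $ i \<le> act m v u $ i"
    using v(2)
  proof (induction v rule: rev_induct)
    case (snoc s v)
    have "tits_refl m s u = u + (- 2 * \<mu> * u $ s) *\<^sub>R axis s 1"
      using u_eig[of "axis s 1"] tits_form_sym[OF m, of "axis s 1" u]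
      by (simp add: tits_refl_def inner_axis)
    then have "act m (v @ [s]) u = act m v u + (- 2 * \<mu> * u $ s) *\<^sub>R act m v (axis s 1)"
      by (simp add: act_append act_Cons linear_add[OF linear_act] linear_scale[OF linear_act] del: scaleR_minus_left)
    moreover have "act m v (axis s 1) $ i \<ge> 0" by (rule reduced_snoc_nonneg[OF m snoc.prems])
    moreover have "- 2 * \<mu> * u $ s \<ge> 0" using neg u_pos[of s] by (simp add: mult_nonpos_nonneg)
    ultimately have "act m v u $ i \<le> act m (v @ [s]) u $ i"
      using mult_nonneg_nonneg[of "- 2 * \<mu> * u $ s" "act m v (axis s 1) $ i"] by simp
    then show ?case using snoc reduced_appendD(1) by fastforce
  qed simp
  then show ?thesis by (simp only: act_cox_eq[OF m v(1)])
qed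

lemma inner_u_act_pos: "u \<bullet> act m w u > 0"
proof -
  have "act m w u $ i > 0" for i using act_ge[of i w] u_pos[of i] by simp
  then show ?thesis by (simp add: inner_vec_def sum_pos u_pos)
qed

lemma act_expansion: "act m w u = (\<Sum>s\<in>UNIV. u $ s *\<^sub>R act m w (axis s 1))"
  by (subst vec_axis_expansion[of u])
    (simp add: linear_sum[OF linear_act] linear_scale[OF linear_act])

lemma form_sum_right: "tits_form m x (\<Sum>s\<in>A. f s) = (\<Sum>s\<in>A. tits_form m x (f s))"
  using bilinear_tits_form[of m] linear_sum[of "tits_form m x" f A] by (simp add: bilinear_def)

text \<open>A nontrivial \<open>w\<close> sends some simple root to a non-positive vector, on which
  \<open>B(u, \<cdot>) = \<mu> u \<bullet> \<cdot>\<close> is non-negative because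
  \<open>\<mu> < 0\<close>.\<close>

lemma trivial_if_roots_negative:
  assumes "\<And>s. tits_form m u (act m w (axis s 1)) < 0"
  shows "cox_eq m w []"
proof (rule ccontr)
  assume "\<not> ?thesis"
  then obtain s where s: "\<And>i. act m w (axis s 1) $ i \<le> 0"
    using nontrivial_nonpos_root[OF m] by blast
  have "u \<bullet> act m w (axis s 1) \<le> 0"
    unfolding inner_vec_def inner_real_def
    by (intro sum_nonpos mult_nonneg_nonpos s less_imp_le[OF u_pos])
  then have "tits_form m u (act m w (axis s 1)) \<ge> 0"
    using neg by (simp add: u_eig mult_nonpos_nonpos)
  then show False using assms[of s] by simp
qed

text \<open>Weighted by the coordinates of \<open>u\<close>, these values sum to
  \<open>B(u, w u) = \<mu> u \<bullet> w u\<close>, which is negative.\<close>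

lemma roots_not_all_positive: "\<exists>s. tits_form m u (act m w (axis s 1)) \<le> 0"
proof (rule ccontr)
  assume "\<not> ?thesis"
  then have "0 \<le> (\<Sum>s\<in>UNIV. u $ s * tits_form m u (act m w (axis s 1)))"
    using u_pos by (intro sum_nonneg mult_nonneg_nonneg) (auto intro: less_imp_le simp: not_le)
  also have "\<dots> = tits_form m u (act m w u)"
    by (simp add: act_expansion form_sum_right tits_form_simps)
  also have "\<dots> < 0" using inner_u_act_pos[of w] neg by (simp add: u_eig mult_neg_pos)
  finally show False by simp
qed

text \<open>The function \<open>f w = u \<bullet> w u\<close> satisfies \<open>\<Sum>\<^sub>s f (s w) = (card S - 2 \<mu>) f w\<close> with \<open>\<mu> < 0\<close>, so it is
  unbounded; this yields two roots spanning a hyperbolic plane.\<close>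

lemma ex_hyperbolic_pair: "\<exists>w s t. \<bar>tits_form m (axis s 1) (act m w (axis t 1))\<bar> > 1"
proof (rule ccontr)
  assume "\<not> ?thesis"
  then have bound: "\<bar>tits_form m (axis s 1) (act m w (axis t 1))\<bar> \<le> 1" for w s t
    by (auto simp: not_less)
  define f where "f w = u \<bullet> act m w u" for w
  have f_pos: "f w > 0" for w unfolding f_def by (rule inner_u_act_pos)
  have sum_left: "tits_form m u x = (\<Sum>s\<in>UNIV. u $ s * tits_form m (axis s 1) x)" for x
    using form_sum_right[of x "\<lambda>s. u $ s *\<^sub>R axis s 1" UNIV] vec_axis_expansion[of u]
      tits_form_sym[OF m, of x] by (simp add: tits_form_simps)
  \<comment> \<open>Expanding \<open>u\<close> in the \<open>axis s 1\<close> and \<open>w u\<close>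
    in the \<open>w\<close>-images of the \<open>axis t 1\<close>,
    \<open>\<mu> * f w = B(u, w u)\<close> becomes a weighted sum of pairings, each at least
    -1.\<close>
  define M where "M = (\<Sum>s\<in>UNIV. u $ s * (\<Sum>t\<in>UNIV. u $ t)) / (- \<mu>)"
  have f_le: "f w \<le> M" for w
  proof -
    have "- tits_form m (axis s 1) (act m w u) \<le> (\<Sum>t\<in>UNIV. u $ t)" for s
    proof -
      have "- tits_form m (axis s 1) (act m w u) =
          (\<Sum>t\<in>UNIV. u $ t * (- tits_form m (axis s 1) (act m w (axis t 1))))"
        by (simp add: act_expansion form_sum_right tits_form_simps sum_negf)
      also have "\<dots> \<le> (\<Sum>t\<in>UNIV. u $ t * 1)"
        using bound[of s w] u_pos
        by (intro sum_mono mult_left_mono) (auto simp: abs_le_iff intro: less_imp_le)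
      finally show ?thesis by simp
    qed
    then have "(\<Sum>s\<in>UNIV. u $ s * (- tits_form m (axis s 1) (act m w u))) \<le>
        (\<Sum>s\<in>UNIV. u $ s * (\<Sum>t\<in>UNIV. u $ t))"
      using u_pos by (intro sum_mono mult_left_mono) (auto intro: less_imp_le)
    then have "(- \<mu>) * f w \<le> (\<Sum>s\<in>UNIV. u $ s * (\<Sum>t\<in>UNIV. u $ t))"
      using sum_left[of "act m w u"] by (simp add: f_def u_eig sum_negf)
    then show ?thesis using neg unfolding M_def by (simp add: field_simps)
  qed
  then have bdd: "bdd_above (range f)" by (auto simp: bdd_above_def)
  define F where "F = Sup (range f)"
  have F: "f w \<le> F" for w unfolding F_def by (rule cSup_upper[OF _ bdd]) simp
  define n where "n = real CARD('s)"
  have step: "(n - 2 * \<mu>) * f w \<le> n * F" for w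
  proof -
    have "f (s # w) = f w - 2 * (u $ s * tits_form m (axis s 1) (act m w u))" for s
      by (simp add: f_def act_Cons tits_refl_def inner_diff_right inner_axis)
    then have "(\<Sum>s\<in>UNIV. f (s # w)) = n * f w - 2 * tits_form m u (act m w u)"
      by (simp add: sum_subtractf sum_distrib_left[symmetric] sum_left n_def)
    also have "\<dots> = (n - 2 * \<mu>) * f w" by (simp add: u_eig f_def algebra_simps)
    finally show ?thesis
      using sum_bounded_above[of UNIV "\<lambda>s. f (s # w)" F] F by (simp add: n_def)
  qed
  have pos: "n - 2 * \<mu> > 0" using neg by (simp add: n_def add_pos_pos)
  \<comment> \<open>Passing to the supremum in \<open>step\<close> gives
    \<open>(n - 2 * \<mu>) * F \<le> n * F\<close>, impossible for
    \<open>\<mu> < 0 < F\<close>.\<close>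
  have "F \<le> n * F / (n - 2 * \<mu>)"
    unfolding F_def by (rule cSup_least) (use step pos in \<open>auto simp: field_simps F_def\<close>)
  then have "(n - 2 * \<mu>) * F \<le> n * F" using pos by (simp add: field_simps)
  moreover have "F > 0" using F[of "[]"] f_pos[of "[]"] by simp
  then have "- (2 * \<mu> * F) > 0" using neg by (simp add: mult_neg_pos)
  ultimately show False by (simp add: algebra_simps)
qed

end

lemma symmetric_form_tits: "coxeter_matrix m \<Longrightarrow> symmetric_form (tits_form m)"
  by unfold_locales (rule bilinear_tits_form, rule tits_form_sym)

text \<open>\<open>all_mirrors\<close> is applied to the simple roots, with the hyperbolic pair
  consisting of a simple root and a \<open>W\<close>-translate of one.\<close>

lemma (in negative_coxeter) refl_in_endo_closure:
  assumes irr: "coxeter_irreducible m"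
  shows "symmetric_form.refl (tits_form m) c \<in> endo_closure (range (act m))"
proof -
  interpret symmetric_form "tits_form m" by (rule symmetric_form_tits[OF m])
  interpret reflection_monoid "tits_form m" "range (act m)"
    by unfold_locales (blast intro: linear_act id_range_act comp_range_act)+
  have axis: "axis s 1 \<in> mirrors" for s
  proof -
    have "refl (axis s 1) = act m [s]"
      by (simp add: fun_eq_iff refl_def act_Cons tits_refl_def tits_coeff_diag[OF m])
    then show ?thesis
      unfolding mirrors_def using endo_closure_superset[OF H_linear] by auto
  qed
  obtain w s t where wst: "\<bar>tits_form m (axis s 1) (act m w (axis t 1))\<bar> > 1"
    using ex_hyperbolic_pair by blast
  \<comment> \<open>The reflection along a translated root is the conjugate of \<open>r_t\<close> by
    \<open>w\<close>, hence belongs to \<open>W\<close>.\<close>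
  have "refl (act m w (axis t 1)) = act m (w @ [t] @ rev w)"
  proof
    fix v
    have id: "act m w (act m (rev w) v) = v"
      using act_cox_eq[OF m cox_eq_append_rev[OF m, of w]] by (metis act_Nil act_append)
    have "tits_form m (act m w (axis t 1)) v = tits_form m (axis t 1) (act m (rev w) v)"
      using form_act[OF m, of w "axis t 1" "act m (rev w) v"] id by simp
    then show "refl (act m w (axis t 1)) v = act m (w @ [t] @ rev w) v"
      using id by (simp add: refl_def act_append act_Cons tits_refl_def form_act[OF m]
          tits_coeff_diag[OF m] linear_diff[OF linear_act] linear_scale[OF linear_act])
  qed
  then have root: "act m w (axis t 1) \<in> mirrors"
    unfolding mirrors_def using endo_closure_superset[OF H_linear] by auto
  have "mirrors = UNIV"
  proof (rule all_mirrors[OF _ _ _ _ axis root _ _ wst])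
    let ?E = "range (\<lambda>s. axis s 1) :: (real ^ 's) set"
    show "?E \<subseteq> mirrors" using axis by blast
    show "tits_form m e e > 0" if "e \<in> ?E" for e
      using that by (auto simp: tits_coeff_diag[OF m])
    have "x \<in> span ?E" for x :: "real ^ 's"
      by (subst vec_axis_expansion) (intro span_sum span_scale span_base rangeI)
    then show "span ?E = UNIV" by blast
    \<comment> \<open>A path in the Coxeter graph leaving \<open>E'\<close> would cross an edge,
      whose two simple roots are not orthogonal.\<close>
    show "E' = {} \<or> E' = ?E" if E': "E' \<subseteq> ?E" "\<forall>x\<in>E'. \<forall>y\<in>?E - E'. tits_form m x y = 0" for E'
    proof (rule ccontr)
      assume "\<not> ?thesis"
      then obtain a b where ab: "axis a 1 \<in> E'" "axis b 1 \<notin> E'" using E'(1) by blast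
      have "(a, b) \<in> (coxeter_graph m)\<^sup>*" using irr by (simp add: coxeter_irreducible_def)
      then have "axis b 1 \<in> E'"
      proof (induction rule: rtrancl_induct)
        case (step b c)
        show ?case
        proof (rule ccontr)
          assume "axis c 1 \<notin> E'"
          then have "tits_form m (axis b 1) (axis c 1) = 0" using E'(2) step.IH by blast
          then show False using tits_coeff_edge[OF step.hyps(2)] by simp
        qed
      qed (rule ab)
      then show False using ab by simp
    qed
  qed (simp_all add: tits_coeff_diag[OF m] form_act[OF m])
  then show ?thesis by (auto simp: mirrors_def)
qed

subsection \<open>Generation by reflections modulo the kernel\<close>

context symmetric_form
begin

definition refls :: "'v list \<Rightarrow> 'v \<Rightarrow> 'v" where
  "refls cs = foldr (\<lambda>c f. refl c \<circ> f) cs id"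

lemma refls_Nil [simp]: "refls [] v = v"
  by (simp add: refls_def)

lemma refls_Cons: "refls (c # cs) = refl c \<circ> refls cs"
  by (simp add: refls_def)

lemma refls_append: "refls (cs @ ds) v = refls cs (refls ds v)"
  by (induction cs) (simp_all add: refls_Cons)

lemma refls_rev: "refls (rev cs) (refls cs v) = v"
  by (induction cs arbitrary: v) (simp_all add: refls_Cons refls_append)

lemma linear_refls: "linear (refls cs)"
proof (induction cs)
  case Nil
  have "refls [] = id" by (simp add: fun_eq_iff)
  then show ?case by (simp only: linear_id)
next
  case (Cons c cs)
  show ?case unfolding refls_Cons by (rule linear_compose[OF Cons linear_refl])
qed

lemma form_refls [simp]: "B (refls cs v) (refls cs w) = B v w"
  by (induction cs) (simp_all add: refls_Cons)

lemma refls_ker: "v \<in> form_ker B \<Longrightarrow> refls cs v = v"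
  by (induction cs) (simp_all add: refls_Cons refl_ker)

lemma refls_orth_fix: "refls cs \<in> carrier (orth_fix_group B)"
proof -
  have "bij (refls cs)"
  proof (rule o_bij)
    show "refls (rev cs) \<circ> refls cs = id" by (simp add: fun_eq_iff refls_rev)
    show "refls cs \<circ> refls (rev cs) = id" using refls_rev[of "rev cs"] by (simp add: fun_eq_iff)
  qed
  then show ?thesis
    using linear_refls refls_ker by (auto simp: orth_fix_group_def Bij_def)
qed

definition frame :: "'v set \<Rightarrow> bool" where
  "frame A \<longleftrightarrow> finite A \<and> (\<forall>a\<in>A. B a a \<noteq> 0) \<and> (\<forall>a\<in>A. \<forall>b\<in>A. a \<noteq> b \<longrightarrow> B a b = 0)"

lemma form_sum_right: "B x (\<Sum>a\<in>A. f a) = (\<Sum>a\<in>A. B x (f a))"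
  using bilinear linear_sum[of "B x" f A] by (simp add: bilinear_def)

lemma form_frame_sum:
  assumes "frame A" "b \<in> A"
  shows "B b (\<Sum>a\<in>A. f a *\<^sub>R a) = f b * B b b"
proof -
  have "B b (\<Sum>a\<in>A. f a *\<^sub>R a) = (\<Sum>a\<in>A. if a = b then f b * B b b else 0)"
    unfolding form_sum_right
    using assms by (intro sum.cong) (auto simp: frame_def form_simps)
  then show ?thesis using assms by (simp add: frame_def)
qed

lemma card_frame_le:
  assumes "frame A"
  shows "card A \<le> DIM('v)"
proof -
  have "independent A"
  proof (rule independent_if_scalars_zero)
    show "finite A" using assms by (simp add: frame_def)
    fix f b assume "(\<Sum>a\<in>A. f a *\<^sub>R a) = 0" "b \<in> A"
    then have "f b * B b b = 0" using form_frame_sum[OF assms, of b f] by (simp add: form_simps)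
    then show "f b = 0" using assms \<open>b \<in> A\<close> by (simp add: frame_def)
  qed
  then show ?thesis using independent_bound by blast
qed

text \<open>By polarization \<open>B\<close> vanishes on the orthogonal complement of
  \<open>A\<close>, and every vector is the sum of its projection to the span of \<open>A\<close>
  and a vector of that complement.\<close>

lemma isotropic_complement_ker:
  assumes A: "frame A" and iso: "\<And>x. (\<forall>a\<in>A. B a x = 0) \<Longrightarrow> B x x = 0"
    and x: "\<forall>a\<in>A. B a x = 0"
  shows "x \<in> form_ker B"
proof -
  have "B x z = 0" for z
  proof -
    define y where "y = z - (\<Sum>a\<in>A. (B a z / B a a) *\<^sub>R a)"
    have "B a y = 0" if "a \<in> A" for a
      using form_frame_sum[OF A that, of "\<lambda>a. B a z / B a a"] A that
      by (simp add: y_def form_simps frame_def)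
    then have y: "\<forall>a\<in>A. B a y = 0" by blast
    then have "\<forall>a\<in>A. B a (x + y) = 0" using x by (simp add: form_simps)
    then have "B (x + y) (x + y) = 0" "B x x = 0" "B y y = 0" using iso x y by blast+
    then have "B x y = 0" by (simp add: form_simps sym[of y x])
    moreover have "B x z = B x y + (\<Sum>a\<in>A. B a z / B a a * B x a)"
      by (simp add: y_def form_simps form_sum_right)
    ultimately show ?thesis using x by (simp add: sym[of x])
  qed
  then show ?thesis by (simp add: form_ker_def)
qed

text \<open>A weak form of the Cartan--Dieudonne theorem: take a maximal frame that can be fixed after
  composing \<open>f\<close> with reflections; its orthogonal complement consists of isotropic vectors, hence is
  the kernel. For \<open>B x x = B y y \<noteq> 0\<close>, one of \<open>x - y\<close>, \<open>x + y\<close> is not isotropic.\<close>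

lemma isometry_eq_refls:
  assumes f: "\<And>v w. B (f v) (f w) = B v w"
  shows "\<exists>cs. \<forall>v. refls cs (f v) - v \<in> form_ker B"
proof -
  note K = subspace_form_ker[OF bilinear]
  define P where "P A \<longleftrightarrow> frame A \<and> (\<exists>cs. \<forall>a\<in>A. refls cs (f a) - a \<in> form_ker B)" for A
  have P0: "P {}" by (simp add: P_def frame_def)
  have "\<forall>A. P A \<longrightarrow> card A < Suc DIM('v)"
    using card_frame_le by (simp add: P_def less_Suc_eq_le)
  from ex_has_greatest_nat[OF P0 this]
  obtain A where A: "P A" and max: "\<forall>A'. P A' \<longrightarrow> card A' \<le> card A" by blast
  then obtain cs where frame: "frame A" and cs: "\<forall>a\<in>A. refls cs (f a) - a \<in> form_ker B"
    by (auto simp: P_def)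
  define h where "h v = refls cs (f v)" for v
  have h: "B (h v) (h w) = B v w" for v w by (simp add: h_def f)
  have ker: "B x (h a) = B x a" if "a \<in> A" for x a
  proof -
    have "B (h a - a) x = 0" using cs that by (simp add: h_def form_ker_def)
    then show ?thesis by (simp add: form_simps sym[of x])
  qed
  have iso: "B x x = 0" if x: "\<forall>a\<in>A. B a x = 0" for x
  proof (rule ccontr)
    assume nz: "B x x \<noteq> 0"
    \<comment> \<open>\<open>h\<close> fixes \<open>A\<close> modulo the kernel, so
      \<open>h x\<close> is again orthogonal to \<open>A\<close>, and the reflections along
      \<open>x - h x\<close>, \<open>x + h x\<close> and \<open>x\<close> leave each
      \<open>h a\<close> in place.\<close>
    have hx: "B a (h x) = 0" if "a \<in> A" for a
      using h[of x a] ker[OF that] x that by (simp add: sym[of "h x"] sym[of x])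
    have fix_A: "refl c (h a) = h a" if "a \<in> A" "\<forall>a\<in>A. B a c = 0" for a c
      using that ker[OF that(1), of c] sym[of c a] by (intro refl_orthogonal) simp
    have "\<exists>ds. refls ds (h x) = x \<and> (\<forall>a\<in>A. refls ds (h a) = h a)"
    proof (cases "B (x - h x) (x - h x) = 0")
      case False
      have "2 * B (x - h x) (h x) = - B (x - h x) (x - h x)"
        using h[of x x] by (simp add: form_simps sym[of "h x" x])
      then have "refl (x - h x) (h x) = x" using False by (simp add: refl_def)
      then have "refls [x - h x] (h x) = x" by (simp add: refls_Cons)
      moreover have "\<forall>a\<in>A. refls [x - h x] (h a) = h a"
        using fix_A hx x by (simp add: refls_Cons form_simps)
      ultimately show ?thesis by blast
    next
      case True
      have sum: "B (x + h x) (x + h x) = 2 * B (x + h x) (h x)"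
        using h[of x x] by (simp add: form_simps sym[of "h x" x])
      have "B (x + h x) (x + h x) + B (x - h x) (x - h x) = 4 * B x x"
        using h[of x x] by (simp add: form_simps sym[of "h x" x])
      then have "B (x + h x) (x + h x) \<noteq> 0" using True nz by simp
      then have "refl (x + h x) (h x) = - x" using sum by (simp add: refl_def)
      then have "refls [x, x + h x] (h x) = x"
        using nz by (simp add: refls_Cons linear_neg[OF linear_refl] refl_self)
      moreover have "\<forall>a\<in>A. refls [x, x + h x] (h a) = h a"
        using fix_A hx x by (simp add: refls_Cons form_simps)
      ultimately show ?thesis by blast
    qed
    then obtain ds where ds: "refls ds (h x) = x" "\<forall>a\<in>A. refls ds (h a) = h a" by blast
    have "\<forall>a\<in>insert x A. refls (ds @ cs) (f a) - a \<in> form_ker B"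
    proof
      fix a assume "a \<in> insert x A"
      then show "refls (ds @ cs) (f a) - a \<in> form_ker B"
      proof
        assume "a = x"
        then show ?thesis using ds(1) subspace_0[OF K] by (simp add: refls_append h_def)
      next
        assume "a \<in> A"
        then have "refls (ds @ cs) (f a) = refls cs (f a)"
          using ds(2) by (simp add: refls_append h_def)
        then show ?thesis using cs \<open>a \<in> A\<close> by simp
      qed
    qed
    moreover have "frame (insert x A)"
    proof -
      have "B x a = 0" if "a \<in> A" for a using x that sym[of x a] by simp
      then show ?thesis using frame x nz by (auto simp: frame_def)
    qed
    ultimately have "P (insert x A)" by (auto simp: P_def)
    then have "card (insert x A) \<le> card A" using max by blast
    moreover have "x \<notin> A" using x nz by blast
    moreover have "finite A" using frame by (simp add: frame_def)
    ultimately show False by simp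
  qed
  have "h v - v \<in> form_ker B" for v
  proof (rule isotropic_complement_ker[OF frame iso], simp, intro ballI)
    fix a assume a: "a \<in> A"
    have "B a (h v) = B a v"
      using h[of v a] ker[OF a, of "h v"] by (simp add: sym[of _ a])
    then show "B a (h v - v) = 0" by (simp add: form_simps)
  qed
  then show ?thesis unfolding h_def by blast
qed

section \<open>From isometries of \<open>V\<close> to the orthogonal group of the quotient and its
  projective group\<close>

lemma orth_induced_coset:
  assumes f: "f \<in> carrier (orth_fix_group B)"
  shows "orth_induced B f (ker_coset B v) = ker_coset B (f v)"
proof -
  have "f (v + k) = f v + k" if "k \<in> form_ker B" for k
    using f that by (simp add: orth_fix_group_def linear_add)
  then have "f ` ker_coset B v = ker_coset B (f v)"
    unfolding ker_coset_def by (auto simp: image_iff) metis+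
  then show ?thesis by (simp add: orth_induced_def quot_space_def)
qed

lemma orth_induced_carrier:
  "f \<in> carrier (orth_fix_group B) \<Longrightarrow> orth_induced B f \<in> carrier (orth_group B)"
  using orth_induced_hom[OF bilinear sym] by (auto simp: hom_def)

text \<open>A lift \<open>f\<close> of \<open>g\<close> chosen coset by coset preserves
  \<open>B\<close> but need not be linear; this is why \<open>isometry_eq_refls\<close> speaks of
  arbitrary isometries.\<close>

lemma orth_group_eq_induced_refls:
  assumes g: "g \<in> carrier (orth_group B)"
  shows "\<exists>cs. g = orth_induced B (refls cs)"
proof -
  have gQ: "g X \<in> quot_space B" if "X \<in> quot_space B" for X
    using g that by (auto simp: orth_group_def dest: Bij_imp_funcset)
  then have "\<exists>w. g (ker_coset B v) = ker_coset B w" for v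
    by (metis (no_types, lifting) imageE quot_space_def rangeI)
  then obtain f where f: "\<And>v. g (ker_coset B v) = ker_coset B (f v)" by metis
  have "B (f v) (f w) = B v w" for v w
  proof -
    have "quot_form B (g (ker_coset B v)) (g (ker_coset B w)) = quot_form B (ker_coset B v) (ker_coset B w)"
      using g by (auto simp: orth_group_def quot_space_def)
    then show ?thesis by (simp add: f quot_form_coset[OF bilinear sym])
  qed
  then obtain cs where cs: "\<And>v. refls cs (f v) - v \<in> form_ker B" using isometry_eq_refls by blast
  have "g X = orth_induced B (refls (rev cs)) X" if X: "X \<in> quot_space B" for X
  proof -
    obtain v where v: "X = ker_coset B v" using X by (auto simp: quot_space_def)
    have "refls (rev cs) (refls cs (f v) - v) \<in> form_ker B" using cs refls_ker by metis
    then have "f v - refls (rev cs) v \<in> form_ker B"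
      by (simp add: linear_diff[OF linear_refls] refls_rev)
    then show ?thesis
      by (simp add: v f orth_induced_coset[OF refls_orth_fix] ker_coset_eq_iff[OF bilinear])
  qed
  moreover have "g \<in> extensional (quot_space B)" using g by (simp add: orth_group_def Bij_def)
  moreover have "orth_induced B (refls (rev cs)) \<in> extensional (quot_space B)"
    by (simp add: orth_induced_def)
  ultimately show ?thesis by (blast intro: extensionalityI)
qed

lemma orth_to_proj_eq:
  assumes g: "g \<in> carrier (orth_group B)"
  shows "orth_to_proj B g = {g, \<lambda>X\<in>quot_space B. quot_scale B (-1) (g X)}"
proof -
  interpret G: Group.group "orth_group B" by (rule group_orth_group[OF bilinear])
  have "subgroup (plus_minus_one B) (orth_group B)"
    using normal_plus_minus_one[OF bilinear sym] by (rule normal_imp_subgroup)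
  then have n: "(\<lambda>X\<in>quot_space B. quot_scale B (-1) X) \<in> carrier (orth_group B)"
    by (auto simp: plus_minus_one_def dest: subgroup.subset)
  have gQ: "g X \<in> quot_space B" if "X \<in> quot_space B" for X
    using g that by (auto simp: orth_group_def dest: Bij_imp_funcset)
  have "(\<lambda>X\<in>quot_space B. X) \<otimes>\<^bsub>orth_group B\<^esub> g = g"
    using g by (simp flip: one_orth_group)
  moreover have "(\<lambda>X\<in>quot_space B. quot_scale B (-1) X) \<otimes>\<^bsub>orth_group B\<^esub> g =
      (\<lambda>X\<in>quot_space B. quot_scale B (-1) (g X))"
    unfolding orth_group_mult[OF n g] compose_def by (rule restrict_ext) (simp add: gQ)
  ultimately show ?thesis by (auto simp: orth_to_proj_def r_coset_def plus_minus_one_def)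
qed

lemma orth_proj_eqD:
  assumes f: "f \<in> carrier (orth_fix_group B)" and g: "g \<in> carrier (orth_fix_group B)"
    and eq: "orth_proj B f = orth_proj B g"
  shows "(\<forall>v. f v - g v \<in> form_ker B) \<or> (\<forall>v. f v + g v \<in> form_ker B)"
proof -
  have "orth_induced B f \<in> orth_to_proj B (orth_induced B g)"
    using eq orth_to_proj_eq[OF orth_induced_carrier[OF f]]
    by (metis comp_apply insertI1 orth_proj_def)
  then consider "orth_induced B f = orth_induced B g"
    | "orth_induced B f = (\<lambda>X\<in>quot_space B. quot_scale B (-1) (orth_induced B g X))"
    using orth_to_proj_eq[OF orth_induced_carrier[OF g]] by auto
  then show ?thesis
  proof cases
    case 1
    have "ker_coset B (f v) = ker_coset B (g v)" for v
      using fun_cong[OF 1, of "ker_coset B v"]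
      by (simp add: orth_induced_coset[OF f] orth_induced_coset[OF g])
    then show ?thesis by (simp add: ker_coset_eq_iff[OF bilinear])
  next
    case 2
    have "ker_coset B (f v) = ker_coset B (- g v)" for v
      using fun_cong[OF 2, of "ker_coset B v"]
      by (simp add: orth_induced_coset[OF f] orth_induced_coset[OF g] quot_space_def
          quot_scale_coset[OF bilinear])
    then show ?thesis by (simp add: ker_coset_eq_iff[OF bilinear])
  qed
qed

lemma form_quot_dual: "(\<lambda>X. quot_form B (ker_coset B x) X) \<in> quot_dual B"
  by (auto simp: quot_dual_def quot_space_def quot_add_coset[OF bilinear]
      quot_scale_coset[OF bilinear] quot_form_coset[OF bilinear sym] form_simps)

text \<open>A functional on the quotient becomes a linear functional on \<open>V\<close> when
  composed with the coset map. This carries Zariski questions over to \<open>End V\<close>.\<close>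

lemma orth_poly_endo_poly:
  assumes "orth_poly B p"
  shows "\<exists>P. endo_poly P \<and> (\<forall>f\<in>carrier (orth_fix_group B). P f = p (orth_induced B f))"
  using assms
proof (induction rule: orth_poly.induct)
  case (coeff \<phi> X)
  then obtain v where v: "X = ker_coset B v" by (auto simp: quot_space_def)
  have *: "\<phi> (ker_coset B (x + y)) = \<phi> (ker_coset B x) + \<phi> (ker_coset B y)"
    "\<phi> (ker_coset B (c *\<^sub>R x)) = c * \<phi> (ker_coset B x)" for x y c
    using coeff(1) by (auto simp: quot_dual_def quot_space_def simp flip: quot_add_coset[OF bilinear]
        quot_scale_coset[OF bilinear])
  have "linear (\<lambda>x. \<phi> (ker_coset B x))" by (rule linearI) (simp_all add: *)
  then have "endo_poly (\<lambda>f. \<phi> (ker_coset B (f v)))" by (rule endo_poly.coeff)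
  then show ?case using orth_induced_coset v by auto
next
  case (const c)
  show ?case using endo_poly.const by blast
next
  case (add p q)
  then show ?case using endo_poly.add by (metis (no_types, lifting))
next
  case (mult p q)
  then show ?case using endo_poly.mult by (metis (no_types, lifting))
qed

text \<open>Every element of the projective group is the image of a product of reflections, and such
  products lie in the closure of \<open>H\<close>. A regular function vanishing on the image of
  \<open>H\<close> pulls back to a polynomial vanishing on \<open>H\<close>, hence on these
  products.\<close>

lemma zariski_dense_orth_proj:
  assumes HO: "H \<subseteq> carrier (orth_fix_group B)" and refl: "\<And>c. refl c \<in> endo_closure H"
    and id: "id \<in> H" and comp: "\<And>g h. g \<in> H \<Longrightarrow> h \<in> H \<Longrightarrow> g \<circ> h \<in> H"
  shows "zariski_dense B (orth_proj B ` H)"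
proof -
  have linH: "\<forall>h\<in>H. linear h" using HO by (auto simp: orth_fix_group_def)
  have refls: "refls cs \<in> endo_closure H" for cs
  proof (induction cs)
    case Nil
    have "refls [] = id" by (simp add: fun_eq_iff)
    then show ?case using endo_closure_superset[OF linH] id by (metis subsetD)
  next
    case (Cons c cs)
    show ?case unfolding refls_Cons by (rule endo_closure_comp[OF linH comp refl Cons])
  qed
  have carrier: "carrier (proj_orth_group B) = orth_to_proj B ` carrier (orth_group B)"
    by (auto simp: proj_orth_group_def FactGroup_def RCOSETS_def orth_to_proj_def)
  have "x \<in> Z" if Z: "zariski_closed B Z" "orth_proj B ` H \<subseteq> Z"
    and x: "x \<in> carrier (proj_orth_group B)" for x Z
  proof -
    obtain g where "g \<in> carrier (orth_group B)" "x = orth_to_proj B g" using x carrier by blast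
    then obtain cs where cs: "x = orth_proj B (refls cs)"
      using orth_group_eq_induced_refls by (fastforce simp: orth_proj_def)
    obtain \<F> where \<F>: "\<forall>F\<in>\<F>. proj_orth_regular B F"
        "Z = {x \<in> carrier (proj_orth_group B). \<forall>F\<in>\<F>. F x = 0}"
      using Z(1) by (auto simp: zariski_closed_def)
    have "F x = 0" if F: "F \<in> \<F>" for F
    proof -
      obtain p where p: "orth_poly B p" "\<forall>g\<in>carrier (orth_group B). F (orth_to_proj B g) = p g"
        using \<F>(1) F by (auto simp: proj_orth_regular_def)
      obtain P where P: "endo_poly P" "\<forall>f\<in>carrier (orth_fix_group B). P f = p (orth_induced B f)"
        using orth_poly_endo_poly[OF p(1)] by blast
      have PF: "P f = F (orth_proj B f)" if "f \<in> carrier (orth_fix_group B)" for f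
        using that P(2) p(2) orth_induced_carrier by (simp add: orth_proj_def)
      have "P h = 0" if h: "h \<in> H" for h
      proof -
        have "orth_proj B h \<in> Z" using h Z(2) by blast
        then show ?thesis using PF h HO F \<F>(2) by auto
      qed
      then have "P (refls cs) = 0" using refls P(1) by (auto simp: endo_closure_def)
      then show ?thesis by (simp add: cs PF refls_orth_fix)
    qed
    then show ?thesis using x \<F>(2) by blast
  qed
  moreover have "zariski_closed B (carrier (proj_orth_group B))"
    unfolding zariski_closed_def by (rule exI[of _ "{}"]) simp
  moreover have "orth_proj B ` H \<subseteq> carrier (proj_orth_group B)"
    using HO orth_induced_carrier by (auto simp: carrier orth_proj_def)
  ultimately show ?thesis unfolding zariski_dense_def by blast
qed

text \<open>Discreteness is tested on the open sets where finitely many values of the form have a common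
  strict sign; they are invariant under \<open>-1\<close>, hence descend to the projective group.\<close>

lemma openin_orth_sign:
  assumes "finite E"
  shows "openin (orth_topology B) {g \<in> carrier (orth_group B).
    \<forall>e\<in>E. r * quot_form B (ker_coset B x) (g (ker_coset B e)) < 0}"
proof -
  have basis: "openin (orth_topology B) {g \<in> carrier (orth_group B).
      quot_form B (ker_coset B x) (g (ker_coset B e)) \<in> U}" if "open U" for e U
    unfolding orth_topology_def
    by (rule topology_generated_by_Basis, intro CollectI exI conjI, rule HOL.refl,
        rule form_quot_dual) (use that in \<open>auto simp: quot_space_def\<close>)
  have gen: "openin (orth_topology B) {g \<in> carrier (orth_group B).
      quot_form B (ker_coset B x) (g (ker_coset B e)) \<in> {y. r * y < 0}}" for e
    by (rule basis) (intro open_Collect_less continuous_intros)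
  have carrier: "openin (orth_topology B) (carrier (orth_group B))"
  proof -
    have "openin (orth_topology B) {g \<in> carrier (orth_group B).
      quot_form B (ker_coset B x) (g (ker_coset B 0)) \<in> UNIV}"
      by (rule basis) simp
    then show ?thesis by simp
  qed
  show ?thesis
    using assms
  proof (induction E rule: finite_induct)
    case empty
    then show ?case using carrier by simp
  next
    case (insert e E)
    have "{g \<in> carrier (orth_group B).
        \<forall>e\<in>insert e E. r * quot_form B (ker_coset B x) (g (ker_coset B e)) < 0} =
      {g \<in> carrier (orth_group B).
        quot_form B (ker_coset B x) (g (ker_coset B e)) \<in> {y. r * y < 0}} \<inter>
      {g \<in> carrier (orth_group B). \<forall>e\<in>E. r * quot_form B (ker_coset B x) (g (ker_coset B e)) < 0}"
      by auto
    then show ?case by (simp only: openin_Int[OF gen insert.IH])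
  qed
qed

lemma ex_openin_proj_sign:
  assumes E: "finite E"
  obtains V where "openin (proj_orth_topology B) V"
    "\<And>f. f \<in> carrier (orth_fix_group B) \<Longrightarrow>
      orth_proj B f \<in> V \<longleftrightarrow> (\<forall>e\<in>E. B x (f e) < 0) \<or> (\<forall>e\<in>E. B x (f e) > 0)"
proof -
  \<comment> \<open>\<open>r = 1\<close> encodes all values negative, \<open>r = -1\<close> all
    positive. Multiplication by -1 exchanges the two sets, so their union is the full preimage of
    \<open>V\<close>.\<close>
  define S where "S r = {g \<in> carrier (orth_group B).
    \<forall>e\<in>E. r * quot_form B (ker_coset B x) (g (ker_coset B e)) < 0}" for r :: real
  define V where "V = orth_to_proj B ` (S 1 \<union> S (-1))"
  have neg: "quot_form B (ker_coset B x) (quot_scale B (-1) X) = - quot_form B (ker_coset B x) X"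
    if "X \<in> quot_space B" for X
    using that by (auto simp: quot_space_def quot_scale_coset[OF bilinear]
        quot_form_coset[OF bilinear sym] form_simps)
  have mem: "orth_to_proj B g \<in> V \<longleftrightarrow> g \<in> S 1 \<union> S (-1)" if g: "g \<in> carrier (orth_group B)" for g
  proof
    assume "orth_to_proj B g \<in> V"
    then obtain h r where h: "orth_to_proj B g = orth_to_proj B h" "h \<in> S r" "r = 1 \<or> r = -1"
      by (auto simp: V_def)
    then have hO: "h \<in> carrier (orth_group B)" by (simp add: S_def)
    have "g \<in> orth_to_proj B h" using h(1) orth_to_proj_eq[OF g] by auto
    then consider "g = h" | "g = (\<lambda>X\<in>quot_space B. quot_scale B (-1) (h X))"
      using orth_to_proj_eq[OF hO] by auto
    then show "g \<in> S 1 \<union> S (-1)"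
    proof cases
      case 2
      have "h X \<in> quot_space B" if "X \<in> quot_space B" for X
        using hO that by (auto simp: orth_group_def dest: Bij_imp_funcset)
      then have "quot_form B (ker_coset B x) (g (ker_coset B e)) =
          - quot_form B (ker_coset B x) (h (ker_coset B e))" for e
        by (simp add: 2 quot_space_def neg)
      then have "g \<in> S (- r)" using h(2) g by (simp add: S_def)
      then show ?thesis using h(3) by auto
    qed (use h in auto)
  qed (simp add: V_def)
  have sub: "S r \<subseteq> carrier (orth_group B)" for r by (auto simp: S_def)
  have "{g \<in> carrier (orth_group B). orth_to_proj B g \<in> V} = S 1 \<union> S (-1)"
    using mem sub by blast
  moreover have "openin (orth_topology B) (S r)" for r
    unfolding S_def by (rule openin_orth_sign[OF E])
  moreover have "V \<subseteq> carrier (proj_orth_group B)"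
    using sub by (auto simp: V_def proj_orth_group_def FactGroup_def RCOSETS_def orth_to_proj_def)
  ultimately have "openin (proj_orth_topology B) V"
    by (simp add: openin_proj_orth_topology openin_Un)
  moreover have "orth_proj B f \<in> V \<longleftrightarrow> (\<forall>e\<in>E. B x (f e) < 0) \<or> (\<forall>e\<in>E. B x (f e) > 0)"
    if f: "f \<in> carrier (orth_fix_group B)" for f
    using mem[OF orth_induced_carrier[OF f]] orth_induced_carrier[OF f]
    by (simp add: orth_proj_def S_def orth_induced_coset[OF f] quot_form_coset[OF bilinear sym])
  ultimately show ?thesis using that by blast
qed

end

subsection \<open>Injectivity, discreteness and density\<close>

context negative_coxeter
begin

lemma act_orth_fix: "act m w \<in> carrier (orth_fix_group (tits_form m))"
  unfolding act_def by (rule tits_word_orth_fix[OF m])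

lemma form_act_swap: "tits_form m (act m v x) (act m w y) = tits_form m x (act m (rev v @ w) y)"
proof -
  have "act m v (act m (rev v @ w) y) = act m w y"
    using act_cox_eq[OF m cox_eq_append_rev[OF m, of v]] by (metis act_Nil act_append)
  then show ?thesis using form_act[OF m, of v x "act m (rev v @ w) y"] by simp
qed

text \<open>Moving \<open>v\<close> to the other side leaves the element \<open>rev v @ w\<close>
  paired with \<open>u\<close>: all signs negative makes it trivial, all positive cannot
  occur.\<close>

lemma cox_eq_if_common_sign:
  assumes "(\<forall>s. tits_form m (act m v u) (act m w (axis s 1)) < 0) \<or>
    (\<forall>s. tits_form m (act m v u) (act m w (axis s 1)) > 0)"
  shows "cox_eq m w v"
proof -
  have "cox_eq m (rev v @ w) []"
    using assms trivial_if_roots_negative[of "rev v @ w"] roots_not_all_positive[of "rev v @ w"]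
    unfolding form_act_swap by (metis not_le)
  then show ?thesis using cox_eq_cancel_left[OF m, of "rev v" w "[]"] by simp
qed

lemma form_u_axis: "tits_form m (act m v u) (act m v (axis s 1)) < 0"
  using neg u_pos[of s] by (simp add: form_act[OF m] u_eig inner_axis mult_neg_pos)

text \<open>Equality in the projective group means equality modulo the kernel up to one global sign,
  so the pairings of \<open>w\<close> with \<open>v u\<close> inherit a common sign from those of
  \<open>v\<close>.\<close>

lemma orth_proj_act_inj:
  assumes "orth_proj (tits_form m) (act m w) = orth_proj (tits_form m) (act m v)"
  shows "cox_eq m w v"
proof -
  interpret symmetric_form "tits_form m" by (rule symmetric_form_tits[OF m])
  have "(\<forall>x. act m w x - act m v x \<in> form_ker (tits_form m)) \<or>
      (\<forall>x. act m w x + act m v x \<in> form_ker (tits_form m))"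
    by (rule orth_proj_eqD[OF act_orth_fix act_orth_fix assms])
  then have "(\<forall>x. tits_form m (act m v u) (act m w x) = tits_form m (act m v u) (act m v x)) \<or>
      (\<forall>x. tits_form m (act m v u) (act m w x) = - tits_form m (act m v u) (act m v x))"
    unfolding form_ker_def by (auto simp: form_simps sym[of "act m v u"] add_eq_0_iff2)
  then show ?thesis using form_u_axis by (intro cox_eq_if_common_sign) fastforce
qed

end

theorem theorem7:
  fixes m :: "'s::finite \<Rightarrow> 's \<Rightarrow> enat"
  assumes "coxeter_matrix m"
    and "non_affine m"
  shows "orth_proj (tits_form m) \<circ> tits_rep m
      \<in> mon (coxeter_group m) (proj_orth_group (tits_form m)) \<and>
    subtopology (proj_orth_topology (tits_form m))
        ((orth_proj (tits_form m) \<circ> tits_rep m) ` carrier (coxeter_group m)) =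
      discrete_topology ((orth_proj (tits_form m) \<circ> tits_rep m) ` carrier (coxeter_group m)) \<and>
    zariski_dense (tits_form m)
      ((orth_proj (tits_form m) \<circ> tits_rep m) ` carrier (coxeter_group m))"
proof -
  obtain u \<mu> where u: "\<mu> < 0" "\<And>s. u $ s > 0" "\<And>w. tits_form m u w = \<mu> * (u \<bullet> w)"
    using negative_eigenvector[OF assms] by metis
  interpret negative_coxeter m u \<mu> by unfold_locales (use assms u in auto)
  interpret symmetric_form "tits_form m" by (rule symmetric_form_tits[OF m])
  define \<rho> where "\<rho> = orth_proj (tits_form m) \<circ> tits_rep m"
  define cls where "cls w = pres_class (coxeter_relators m) (letters w)" for w
  have carrier: "carrier (coxeter_group m) = range cls"
  proof -
    have "pres_class (coxeter_relators m) w = cls (map fst w)" for w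
      unfolding cls_def pres_class_eq_iff by (rule pres_eq_letters[OF m])
    then have "range (pres_class (coxeter_relators m)) = range cls"
      unfolding cls_def by blast
    then show ?thesis by (simp add: coxeter_group_def presented_group_def)
  qed
  have \<rho>_cls: "\<rho> (cls w) = orth_proj (tits_form m) (act m w)" for w
    by (simp add: \<rho>_def cls_def tits_rep_pres_class[OF m] act_def)
  have cls_eq: "cls v = cls w \<longleftrightarrow> cox_eq m v w" for v w
    by (simp add: cls_def pres_class_eq_iff cox_eq_def)
  have "\<rho> \<in> hom (coxeter_group m) (proj_orth_group (tits_form m))"
    unfolding \<rho>_def by (rule hom_compose[OF tits_rep_hom[OF m] orth_proj_hom[OF bilinear sym]])
  moreover have "inj_on \<rho> (carrier (coxeter_group m))"
    unfolding carrier inj_on_def ball_simps \<rho>_cls cls_eq using orth_proj_act_inj by blast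
  ultimately have mon: "\<rho> \<in> mon (coxeter_group m) (proj_orth_group (tits_form m))"
    by (simp add: mon_def)
  define T where "T = \<rho> ` carrier (coxeter_group m)"
  have T: "T = orth_proj (tits_form m) ` range (act m)"
    by (simp only: T_def carrier image_image \<rho>_cls)
  \<comment> \<open>The neighbourhood of the image of \<open>v\<close> consists of the elements
    whose pairings with \<open>v u\<close> share a strict sign; \<open>v\<close> is the only element
    of \<open>W\<close> with this property.\<close>
  have single: "\<exists>V. openin (proj_orth_topology (tits_form m)) V \<and> V \<inter> T = {x}" if x: "x \<in> T" for x
  proof -
    obtain v where v: "x = orth_proj (tits_form m) (act m v)" using x T by blast
    obtain V where V: "openin (proj_orth_topology (tits_form m)) V"
        "\<And>f. f \<in> carrier (orth_fix_group (tits_form m)) \<Longrightarrow> orth_proj (tits_form m) f \<in> V \<longleftrightarrow>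
          (\<forall>e\<in>range (\<lambda>s. axis s 1). tits_form m (act m v u) (f e) < 0) \<or>
          (\<forall>e\<in>range (\<lambda>s. axis s 1). tits_form m (act m v u) (f e) > 0)"
      by (rule ex_openin_proj_sign[of "range (\<lambda>s. axis s 1)" "act m v u"]) (simp, blast)
    note V_act = V(2)[OF act_orth_fix]
    have "x \<in> V" unfolding v V_act using form_u_axis by blast
    moreover have "y = x" if y: "y \<in> V" "y \<in> T" for y
    proof -
      obtain w where w: "y = orth_proj (tits_form m) (act m w)" using y(2) T by blast
      then have "cox_eq m w v" using y(1) V_act[of w] by (intro cox_eq_if_common_sign) auto
      then show ?thesis using act_cox_eq[OF m] v w by metis
    qed
    ultimately show ?thesis using V(1) x by blast
  qed
  have "subtopology (proj_orth_topology (tits_form m)) T = discrete_topology T"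
  proof -
    have "T \<subseteq> topspace (proj_orth_topology (tits_form m))"
      using single openin_subset by fastforce
    then have "topspace (subtopology (proj_orth_topology (tits_form m)) T) = T"
      by (auto simp: topspace_subtopology)
    moreover have "openin (subtopology (proj_orth_topology (tits_form m)) T) {x}" if "x \<in> T" for x
      using single[OF that] by (auto simp: openin_subtopology)
    ultimately show ?thesis by (metis discrete_topology_unique)
  qed
  moreover have "zariski_dense (tits_form m) T"
    unfolding T
  proof (rule zariski_dense_orth_proj)
    show "refl c \<in> endo_closure (range (act m))" for c
      using refl_in_endo_closure assms(2) by (simp add: non_affine_def)
  qed (blast intro: act_orth_fix id_range_act comp_range_act)+
  ultimately show ?thesis using mon unfolding T_def \<rho>_def by blast
qed

end
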